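(* Let $(P,p,M,G)$ be a principal bundle with semi-simple structure group $G$ over a manifold $M$ equipped with a fixed flat Lorentzian (Minkowskian) metric, and work in coordinates in which the metric has the constant diagonal form $\eta_{\mu\nu}$. Let $C_P\to M$ be the bundle of principal connections on $P$, with coordinates $(x^\mu,\omega^A_\mu)$, and let $\lambda_{YM}=-\frac14F^A_{\mu\nu}\eta^{\mu\rho}\eta^{\nu\sigma}F^B_{\rho\sigma}\delta_{AB}\,ds$ be the Yang--Mills Lagrangian. Then, along critical solutions of $\lambda_{YM}$, a vertical vector field $\Xi=\Xi^Z_\sigma\frac{\partial}{\partial\omega^Z_\sigma}$ on $C_P$ satisfies the Jacobi equation for $\lambda_{YM}$ if and only if $$\eta^{\nu\sigma}\eta^{\beta\alpha}\Big\{\nabla_\beta\big[(\nabla_\alpha\Xi^A_\sigma-\nabla_\sigma\Xi^A_\alpha)\delta_{BA}\big]+F^D_{\beta\sigma}c^A_{BZ}\Xi^Z_\alpha\delta_{AD}\Big\}=0$$ for every pair $(\nu,B)$.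
   Context: Greek indices are spacetime indices, capital Latin indices label the Lie algebra $\mathfrak g$ of $G$; $ds$ is the coordinate volume form on $M$; $d_\mu$ are total derivatives on the jet spaces of $C_P$; $\omega^A_{\mu,\nu}=d_\nu\omega^A_\mu$. $\delta_{AB}$ are the components of the Cartan--Killing metric in an orthonormal basis $T_A$ of $\mathfrak g$; $c^A_{BC}$ are the structure constants of $\mathfrak g$ in this basis; Latin indices are raised and lowered with $\delta$. The field strength is $F^A_{\mu\nu}=\omega^A_{\nu,\mu}-\omega^A_{\mu,\nu}+c^A_{BC}\omega^B_\mu\omega^C_\nu$. The Euler--Lagrange expressions of $\lambda_{YM}$ are $E^\nu_B=d_\mu F^{\mu\nu}_B+F^{\mu\nu}_Ac^A_{BC}\omega^C_\mu$; critical solutions are sections of $C_P$ along whose prolongations $E^\nu_B=0$. Jacobi equation: for a Lagrangian $\lambda$ with Euler--Lagrange form $E_n(\lambda)$, a vertical vector field $\Xi$ satisfies the Jacobi equation if $E_n(\Xi\rfloor E_n(\lambda))=0$, where the function-valued contraction $\Xi\rfloor E_n(\lambda)$ is regarded as a new Lagrangian; explicitly, for $\lambda_{YM}$ this new Lagrangian is $\Xi^B_\nu E^\nu_B\,ds$. Here the equation is considered evaluated along critical solutions. Covariant derivatives: $\nabla$ is the connection induced by the principal connection $\omega$ (together with the flat connection on the frame bundle of $M$, whose coefficients vanish in the chosen coordinates): $\nabla_\alpha\Xi^A_\sigma=d_\alpha\Xi^A_\sigma+c^A_{CZ}\omega^C_\alpha\Xi^Z_\sigma$, and, on objects with a lower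 Lie algebra index, $\nabla_\beta X_B=d_\beta X_B+X_Ac^A_{BC}\omega^C_\beta$ (with any spacetime indices untouched). *)

theory Defs
  imports "HOL-Analysis.Analysis" "HOL-Library.Multiset" "HOL-Library.Groups_Big_Fun"
begin

section \<open>The Lie algebra of the structure group\<close>

definition lie_algebra :: "('a::real_vector \<Rightarrow> 'a \<Rightarrow> 'a) \<Rightarrow> bool" where
  "lie_algebra br \<longleftrightarrow> bilinear br \<and> (\<forall>x. br x x = 0) \<and>
     (\<forall>x y z. br x (br y z) + br y (br z x) + br z (br x y) = 0)"

definition lie_ideal :: "('a::real_vector \<Rightarrow> 'a \<Rightarrow> 'a) \<Rightarrow> 'a set \<Rightarrow> bool" where
  "lie_ideal br I \<longleftrightarrow> subspace I \<and> (\<forall>x. \<forall>y\<in>I. br x y \<in> I)"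

primrec derived_series :: "('a::real_vector \<Rightarrow> 'a \<Rightarrow> 'a) \<Rightarrow> 'a set \<Rightarrow> nat \<Rightarrow> 'a set" where
  "derived_series br I 0 = I"
| "derived_series br I (Suc n) =
     span {br x y | x y. x \<in> derived_series br I n \<and> y \<in> derived_series br I n}"

definition lie_solvable :: "('a::real_vector \<Rightarrow> 'a \<Rightarrow> 'a) \<Rightarrow> 'a set \<Rightarrow> bool" where
  "lie_solvable br I \<longleftrightarrow> (\<exists>n. derived_series br I n = {0})"

definition semisimple_lie_algebra :: "('a::real_vector \<Rightarrow> 'a \<Rightarrow> 'a) \<Rightarrow> bool" where
  "semisimple_lie_algebra br \<longleftrightarrow> lie_algebra br \<and>
     (\<forall>I. lie_ideal br I \<and> lie_solvable br I \<longrightarrow> I = {0})"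

definition indexed_basis :: "('g::finite \<Rightarrow> 'a::real_vector) \<Rightarrow> bool" where
  "indexed_basis T \<longleftrightarrow> inj T \<and> independent (range T) \<and> span (range T) = UNIV"

text \<open>\<open>structure_constant br T A B C\<close> is $c^A_{BC}$, that is,
  $[T_B, T_C] = \sum_A c^A_{BC} T_A$.\<close>

definition structure_constant ::
    "('a::real_vector \<Rightarrow> 'a \<Rightarrow> 'a) \<Rightarrow> ('g::finite \<Rightarrow> 'a) \<Rightarrow> 'g \<Rightarrow> 'g \<Rightarrow> 'g \<Rightarrow> real" where
  "structure_constant br T A B C = representation (range T) (br (T B) (T C)) (T A)"

text \<open>The Killing form $\mathrm{tr}(\mathrm{ad}_x \circ \mathrm{ad}_y)$; the trace does not depend
  on the basis \<open>T\<close> used to compute it.\<close>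

definition killing_form ::
    "('a::real_vector \<Rightarrow> 'a \<Rightarrow> 'a) \<Rightarrow> ('g::finite \<Rightarrow> 'a) \<Rightarrow> 'a \<Rightarrow> 'a \<Rightarrow> real" where
  "killing_form br T x y = (\<Sum>A\<in>UNIV. representation (range T) (br x (br y (T A))) (T A))"

text \<open>The components $\delta_{AB}$ of the Cartan-Killing metric in the basis \<open>T\<close>. The sign \<open>\<epsilon>\<close>
  accommodates both conventions for the metric: the Killing form of a compact semi-simple group is
  negative definite, and there one usually takes its opposite, so that $\delta$ is the Kronecker
  symbol.\<close>

definition cartan_killing_metric ::
    "real \<Rightarrow> ('a::real_vector \<Rightarrow> 'a \<Rightarrow> 'a) \<Rightarrow> ('g::finite \<Rightarrow> 'a) \<Rightarrow> 'g \<Rightarrow> 'g \<Rightarrow> real" where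
  "cartan_killing_metric \<epsilon> br T A B = \<epsilon> * killing_form br T (T A) (T B)"

text \<open>For a non-compact group the metric is indefinite, hence an orthonormal basis has squared norms
  \<open>1\<close> and \<open>-1\<close>.\<close>

definition orthonormal_components :: "('g \<Rightarrow> 'g \<Rightarrow> real) \<Rightarrow> bool" where
  "orthonormal_components \<delta> \<longleftrightarrow>
     (\<forall>A B. A \<noteq> B \<longrightarrow> \<delta> A B = 0) \<and> (\<forall>A. \<delta> A A = 1 \<or> \<delta> A A = - 1)"


section \<open>The metric on spacetime\<close>

text \<open>Exactly one diagonal entry differs in sign from all the others, so that both signature
  conventions are covered.\<close>

type_synonym 'm metric = "real^'m^'m"

definition lorentzian_diagonal :: "'m::finite metric \<Rightarrow> bool" where
  "lorentzian_diagonal \<eta> \<longleftrightarrow> (\<forall>\<mu> \<nu>. \<mu> \<noteq> \<nu> \<longrightarrow> \<eta> $ \<mu> $ \<nu> = 0) \<and>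
     (\<exists>t. \<eta> $ t $ t \<noteq> 0 \<and> (\<forall>\<mu>. \<mu> \<noteq> t \<longrightarrow> \<eta> $ \<mu> $ \<mu> * \<eta> $ t $ t < 0))"


section \<open>Smooth maps\<close>

primrec C_k_on ::
    "nat \<Rightarrow> ('a::euclidean_space \<Rightarrow> 'b::real_normed_vector) \<Rightarrow> 'a set \<Rightarrow> bool" where
  "C_k_on 0 f S \<longleftrightarrow> continuous_on S f"
| "C_k_on (Suc k) f S \<longleftrightarrow> f differentiable_on S \<and>
     (\<forall>b\<in>Basis. C_k_on k (\<lambda>x. frechet_derivative f (at x) b) S)"

text \<open>Used for open sets only.\<close>

definition smooth_map_on :: "('a::euclidean_space \<Rightarrow> 'b::real_normed_vector) \<Rightarrow> 'a set \<Rightarrow> bool" where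
  "smooth_map_on f S \<longleftrightarrow> (\<forall>k. C_k_on k f S)"


section \<open>Jets of sections of the bundle of connections\<close>

text \<open>Over a coordinate domain of $M$ that trivialises $P$, the bundle $C_P$ has the global
  coordinates $(x^\mu, \omega^A_\mu)$. A point of its infinite jet bundle is a pair \<open>(x, u)\<close>, where
  \<open>u I $ A $ \<mu>\<close> is $\omega^A_{\mu,I}$ for the symmetric multi-index \<open>I\<close>; in particular
  \<open>u {#} $ A $ \<mu>\<close> is $\omega^A_\mu$. Functions on $J^k C_P$ are those that depend only on \<open>x\<close> and on
  the \<open>u I\<close> with \<open>size I \<le> k\<close>.

  The linear order on the spacetime indices only serves to enumerate a multi-index as a list.\<close>

type_synonym 'm base = "real^'m"

type_synonym ('m, 'g) pot = "real^'m^'g"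

type_synonym ('m, 'g) jet = "'m base \<times> ('m multiset \<Rightarrow> ('m, 'g) pot)"

definition dx :: "'m \<Rightarrow> (('m::finite, 'g::finite) jet \<Rightarrow> real) \<Rightarrow> ('m, 'g) jet \<Rightarrow> real" where
  "dx \<mu> f = (\<lambda>(x, u). deriv (\<lambda>t. f (x + t *\<^sub>R axis \<mu> 1, u)) 0)"

text \<open>\<open>du I A \<mu>\<close> is $\partial / \partial \omega^A_{\mu,I}$.\<close>

definition du ::
    "'m multiset \<Rightarrow> 'g \<Rightarrow> 'm \<Rightarrow> (('m::finite, 'g::finite) jet \<Rightarrow> real) \<Rightarrow> ('m, 'g) jet \<Rightarrow> real" where
  "du I A \<mu> f = (\<lambda>(x, u). deriv (\<lambda>t. f (x, u(I := u I + t *\<^sub>R axis A (axis \<mu> 1)))) 0)"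

text \<open>\<^const>\<open>Sum_any\<close> is the sum of a family with finite support; the support is finite here since
  only functions on some $J^k C_P$ are differentiated.\<close>

definition total_deriv ::
    "'m \<Rightarrow> (('m::finite, 'g::finite) jet \<Rightarrow> real) \<Rightarrow> ('m, 'g) jet \<Rightarrow> real" where
  "total_deriv \<mu> f j = dx \<mu> f j +
     Sum_any (\<lambda>I. \<Sum>A\<in>UNIV. \<Sum>\<sigma>\<in>UNIV. snd j (add_mset \<mu> I) $ A $ \<sigma> * du I A \<sigma> f j)"

definition total_deriv_multi ::
    "'m multiset \<Rightarrow> (('m::{finite,linorder}, 'g::finite) jet \<Rightarrow> real) \<Rightarrow> ('m, 'g) jet \<Rightarrow> real" where
  "total_deriv_multi I f = foldr total_deriv (sorted_list_of_multiset I) f"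

text \<open>Component $(\nu, B)$ of the Euler-Lagrange form $E_n(L\,ds)$ of a Lagrangian of arbitrary finite
  order, $\sum_I (-1)^{|I|} d_I (\partial L / \partial \omega^B_{\nu,I})$.\<close>

definition euler_lagrange ::
    "(('m::{finite,linorder}, 'g::finite) jet \<Rightarrow> real) \<Rightarrow> 'm \<Rightarrow> 'g \<Rightarrow> ('m, 'g) jet \<Rightarrow> real" where
  "euler_lagrange L \<nu> B j = Sum_any (\<lambda>I. (-1) ^ size I * total_deriv_multi I (du I B \<nu> L) j)"

definition partial_deriv ::
    "'m \<Rightarrow> ('m::finite base \<Rightarrow> 'b::real_normed_vector) \<Rightarrow> 'm base \<Rightarrow> 'b" where
  "partial_deriv \<mu> s x = frechet_derivative s (at x) (axis \<mu> 1)"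

definition prolongation ::
    "('m base \<Rightarrow> ('m, 'g) pot) \<Rightarrow> 'm base \<Rightarrow> ('m::{finite,linorder}, 'g::finite) jet" where
  "prolongation s x = (x, \<lambda>I. foldr partial_deriv (sorted_list_of_multiset I) s x)"


section \<open>The Yang-Mills Lagrangian and the Jacobi equation\<close>

definition conn :: "'g \<Rightarrow> 'm \<Rightarrow> ('m::finite, 'g::finite) jet \<Rightarrow> real" where
  "conn A \<mu> j = snd j {#} $ A $ \<mu>"

text \<open>\<open>conn_d A \<mu> \<nu>\<close> is $\omega^A_{\mu,\nu}$.\<close>

definition conn_d :: "'g \<Rightarrow> 'm \<Rightarrow> 'm \<Rightarrow> ('m::finite, 'g::finite) jet \<Rightarrow> real" where
  "conn_d A \<mu> \<nu> j = snd j {#\<nu>#} $ A $ \<mu>"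

definition field_strength ::
    "('g \<Rightarrow> 'g \<Rightarrow> 'g \<Rightarrow> real) \<Rightarrow> 'g \<Rightarrow> 'm \<Rightarrow> 'm \<Rightarrow> ('m::finite, 'g::finite) jet \<Rightarrow> real" where
  "field_strength c A \<mu> \<nu> j = conn_d A \<nu> \<mu> j - conn_d A \<mu> \<nu> j +
     (\<Sum>B\<in>UNIV. \<Sum>C\<in>UNIV. c A B C * conn B \<mu> j * conn C \<nu> j)"

text \<open>The density of $\lambda_{YM}$ with respect to $ds$; \<open>h\<close> is the inverse metric
  $\eta^{\mu\nu}$.\<close>

definition yang_mills ::
    "('g \<Rightarrow> 'g \<Rightarrow> 'g \<Rightarrow> real) \<Rightarrow> ('g \<Rightarrow> 'g \<Rightarrow> real) \<Rightarrow> 'm metric \<Rightarrow>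
     ('m::finite, 'g::finite) jet \<Rightarrow> real" where
  "yang_mills c \<delta> h j = - (1/4) *
     (\<Sum>A\<in>UNIV. \<Sum>B\<in>UNIV. \<Sum>\<mu>\<in>UNIV. \<Sum>\<nu>\<in>UNIV. \<Sum>\<rho>\<in>UNIV. \<Sum>\<sigma>\<in>UNIV.
        field_strength c A \<mu> \<nu> j * h $ \<mu> $ \<rho> * h $ \<nu> $ \<sigma> * field_strength c B \<rho> \<sigma> j * \<delta> A B)"

definition critical_section ::
    "(('m::{finite,linorder}, 'g::finite) jet \<Rightarrow> real) \<Rightarrow> 'm base set \<Rightarrow>
     ('m base \<Rightarrow> ('m, 'g) pot) \<Rightarrow> bool" where
  "critical_section L U s \<longleftrightarrow> smooth_map_on s U \<and>
     (\<forall>x\<in>U. \<forall>\<nu> B. euler_lagrange L \<nu> B (prolongation s x) = 0)"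

text \<open>A vertical vector field on $C_P$ is given by its components, which are functions of
  $(x^\mu, \omega^A_\mu)$; \<open>vf_comp \<Xi> Z \<sigma>\<close> is $\Xi^Z_\sigma$, regarded as a function on the jet
  bundle.\<close>

definition vf_comp ::
    "('m base \<times> ('m, 'g) pot \<Rightarrow> ('m, 'g) pot) \<Rightarrow> 'g \<Rightarrow> 'm \<Rightarrow> ('m::finite, 'g::finite) jet \<Rightarrow> real" where
  "vf_comp \<Xi> Z \<sigma> j = \<Xi> (fst j, snd j {#}) $ Z $ \<sigma>"

definition vf_contraction ::
    "('m base \<times> ('m, 'g) pot \<Rightarrow> ('m, 'g) pot) \<Rightarrow> (('m, 'g) jet \<Rightarrow> real) \<Rightarrow>
     ('m::{finite,linorder}, 'g::finite) jet \<Rightarrow> real" where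
  "vf_contraction \<Xi> L j = (\<Sum>B\<in>UNIV. \<Sum>\<nu>\<in>UNIV. vf_comp \<Xi> B \<nu> j * euler_lagrange L \<nu> B j)"

definition jacobi_along ::
    "(('m::{finite,linorder}, 'g::finite) jet \<Rightarrow> real) \<Rightarrow> 'm base set \<Rightarrow>
     ('m base \<Rightarrow> ('m, 'g) pot) \<Rightarrow> ('m base \<times> ('m, 'g) pot \<Rightarrow> ('m, 'g) pot) \<Rightarrow> bool" where
  "jacobi_along L U s \<Xi> \<longleftrightarrow>
     (\<forall>x\<in>U. \<forall>\<nu> B. euler_lagrange (vf_contraction \<Xi> L) \<nu> B (prolongation s x) = 0)"


section \<open>Covariant derivatives\<close>

definition nabla_upper ::
    "('g \<Rightarrow> 'g \<Rightarrow> 'g \<Rightarrow> real) \<Rightarrow> 'm \<Rightarrow> ('g \<Rightarrow> ('m, 'g) jet \<Rightarrow> real) \<Rightarrow> 'g \<Rightarrow>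
     ('m::finite, 'g::finite) jet \<Rightarrow> real" where
  "nabla_upper c \<alpha> X A j = total_deriv \<alpha> (X A) j +
     (\<Sum>C\<in>UNIV. \<Sum>Z\<in>UNIV. c A C Z * conn C \<alpha> j * X Z j)"

definition nabla_lower ::
    "('g \<Rightarrow> 'g \<Rightarrow> 'g \<Rightarrow> real) \<Rightarrow> 'm \<Rightarrow> ('g \<Rightarrow> ('m, 'g) jet \<Rightarrow> real) \<Rightarrow> 'g \<Rightarrow>
     ('m::finite, 'g::finite) jet \<Rightarrow> real" where
  "nabla_lower c \<beta> X B j = total_deriv \<beta> (X B) j +
     (\<Sum>A\<in>UNIV. \<Sum>C\<in>UNIV. X A j * c A B C * conn C \<beta> j)"

end

theory Submission
  imports Defs
begin

text \<open>The equivalence holds jet by jet: at every jet where $E^\nu_B = 0$, the Euler-Lagrange expression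
  of $\Xi^B_\nu E^\nu_B$ equals the left-hand side of the claimed equation. Indeed, where $E$ vanishes
  the derivatives of $\Xi$ with respect to $\omega$ drop out, so that what remains is the formal adjoint
  of the linearisation of $E$, applied to $\Xi$; this linearisation is formally self-adjoint, since $E$
  comes from a Lagrangian, and it is the displayed operator because $\delta F_{\mu\nu} =
  \nabla_\mu \Xi_\nu - \nabla_\nu \Xi_\mu$. Self-adjointness is checked by hand. It needs only the
  antisymmetry of the bracket, the symmetry of the metrics, and the commutation of total derivatives on
  the components of $\Xi$.\<close>

section \<open>Symmetry of second derivatives\<close>

text \<open>The field equations hold only at the jets of the critical section, whereas each term of
  the Euler-Lagrange sum with nonempty \<open>I\<close> carries total derivatives, which compare
  neighbouring jets. Such terms must be computed on all jets over \<open>U\<close>, without using E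
  = 0. This succeeds because \<Xi> depends on x and \<omega> alone, so that differentiating by a jet
  coordinate of positive order does not reach it. Derivatives of \<Xi> by \<omega> itself arise only
  in the term \<open>I = {#}\<close>, which is not totally differentiated and where they multiply E
  at the jet in question. A second obstacle is analytic: \<open>total_deriv\<close> is assembled
  from one-variable derivatives on a space of infinitely many coordinates, and partial derivatives
  alone give no product or chain rule. Derivatives along curves supply these rules. Smoothness of
  \<Xi> is given by iterated derivatives in basis directions; commuting its total derivatives
  therefore rests on the symmetry of second derivatives. Since the metric is diagonal, all index
  contractions shrink to one sum over \<mu>, and self-adjointness can be checked summand by
  summand.\<close>

lemma second_difference_bound:
  fixes f :: "'a::real_normed_vector \<Rightarrow> 'b::real_normed_vector"
  assumes "open U" "x \<in> U"
    and f': "\<And>y. y \<in> U \<Longrightarrow> (f has_derivative f' y) (at y)"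
    and Da: "((\<lambda>y. f' y a) has_derivative Da) (at x)"
    and "e > 0"
  shows "\<exists>d>0. \<forall>t. 0 < t \<and> t < d \<longrightarrow>
    norm (f (x + t *\<^sub>R a + t *\<^sub>R b) - f (x + t *\<^sub>R a) - f (x + t *\<^sub>R b) + f x - (t * t) *\<^sub>R Da b)
      \<le> e * (t * t)"
proof -
  define M where "M = norm a + norm b + 1"
  have M: "M > 0" unfolding M_def by (smt (verit) norm_ge_zero)
  \<comment> \<open>\<open>t * M\<close> bounds every displacement used below, and the slope of
    \<open>\<psi>\<close> will be at most \<open>2 * (e' * (t * M))\<close>. Over an interval of
    length \<open>t\<close> this choice yields exactly \<open>e * (t * t)\<close>.\<close>
  define e' where "e' = e / (2 * M)"
  have e': "e' > 0" using M \<open>e > 0\<close> by (simp add: e'_def)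
  obtain r1 where r1: "r1 > 0" "ball x r1 \<subseteq> U"
    using \<open>open U\<close> \<open>x \<in> U\<close> open_contains_ball by blast
  obtain r2 where r2: "r2 > 0"
    "\<And>y. norm (y - x) < r2 \<Longrightarrow> norm (f' y a - f' x a - Da (y - x)) \<le> e' * norm (y - x)"
    using Da e' unfolding has_derivative_at_alt by blast
  interpret Da: bounded_linear Da using Da by (rule has_derivative_bounded_linear)
  define d where "d = min r1 r2 / M"
  have "d > 0" using r1 r2 M by (simp add: d_def)
  moreover have "norm (f (x + t *\<^sub>R a + t *\<^sub>R b) - f (x + t *\<^sub>R a) - f (x + t *\<^sub>R b) + f x - (t * t) *\<^sub>R Da b)
      \<le> e * (t * t)" if t: "0 < t" "t < d" for t
  proof -
    \<comment> \<open>The increment in direction \<open>b\<close> as a function of the step along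
      \<open>a\<close>, with its expected value removed. The remainder to be bounded is
      \<open>\<psi> t - \<psi> 0\<close>, so the mean value inequality applies.\<close>
    define \<psi> where "\<psi> r = f (x + r *\<^sub>R a + t *\<^sub>R b) - f (x + r *\<^sub>R a) - (r * t) *\<^sub>R Da b" for r
    have tM: "t * M < min r1 r2" using t M by (simp add: d_def field_simps)
    have small: "norm (r *\<^sub>R a + s *\<^sub>R b) \<le> t * M" if "0 \<le> r" "r \<le> t" "0 \<le> s" "s \<le> t" for r s
    proof -
      have "norm (r *\<^sub>R a + s *\<^sub>R b) \<le> r * norm a + s * norm b"
        using that by (metis abs_of_nonneg norm_scaleR norm_triangle_ineq)
      also have "\<dots> \<le> t * norm a + t * norm b"
        using that by (intro add_mono mult_right_mono) auto
      also have "\<dots> \<le> t * M" using t by (simp add: M_def algebra_simps)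
      finally show ?thesis .
    qed
    have inU: "x + r *\<^sub>R a + s *\<^sub>R b \<in> U" if "0 \<le> r" "r \<le> t" "0 \<le> s" "s \<le> t" for r s
    proof -
      have "norm (r *\<^sub>R a + s *\<^sub>R b) < r1" using small[OF that] tM by simp
      then have "x + r *\<^sub>R a + s *\<^sub>R b \<in> ball x r1"
        by (metis add.assoc add_diff_cancel_left' dist_commute dist_norm mem_ball)
      then show ?thesis using r1 by blast
    qed
    have approx: "norm (f' (x + r *\<^sub>R a + s *\<^sub>R b) a - f' x a - Da (r *\<^sub>R a + s *\<^sub>R b)) \<le> e' * (t * M)"
      if "0 \<le> r" "r \<le> t" "0 \<le> s" "s \<le> t" for r s
    proof -
      have "norm (r *\<^sub>R a + s *\<^sub>R b) < r2" using small[OF that] tM by simp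
      then have "norm (f' (x + r *\<^sub>R a + s *\<^sub>R b) a - f' x a - Da (r *\<^sub>R a + s *\<^sub>R b))
         \<le> e' * norm (r *\<^sub>R a + s *\<^sub>R b)"
        using r2(2)[of "x + r *\<^sub>R a + s *\<^sub>R b"] by (simp add: add.assoc)
      also have "\<dots> \<le> e' * (t * M)" using small[OF that] e' by simp
      finally show ?thesis .
    qed
    define \<psi>' where "\<psi>' r = f' (x + r *\<^sub>R a + t *\<^sub>R b) a - f' (x + r *\<^sub>R a) a - t *\<^sub>R Da b" for r
    have der: "(\<psi> has_derivative (\<lambda>h. h *\<^sub>R \<psi>' r)) (at r within {0..t})" if r: "r \<in> {0..t}" for r
    proof -
      have 1: "((\<lambda>r. f (x + r *\<^sub>R a + t *\<^sub>R b)) has_derivative (\<lambda>h. f' (x + r *\<^sub>R a + t *\<^sub>R b) (h *\<^sub>R a)))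
          (at r within {0..t})"
        using r t inU[of r t]
        by (auto intro!: derivative_eq_intros has_derivative_compose[of _ _ _ _ f, OF _ f'])
      have 2: "((\<lambda>r. f (x + r *\<^sub>R a)) has_derivative (\<lambda>h. f' (x + r *\<^sub>R a) (h *\<^sub>R a)))
          (at r within {0..t})"
        using r t inU[of r 0]
        by (auto intro!: derivative_eq_intros has_derivative_compose[of _ _ _ _ f, OF _ f'])
      have l: "f' y (h *\<^sub>R a) = h *\<^sub>R f' y a" if "y \<in> U" for y h
        using f'[OF that] by (metis has_derivative_linear linear_cmul)
      show ?thesis unfolding \<psi>_def
        apply (rule derivative_eq_intros 1 2 refl)+
        using r t inU[of r 0] inU[of r t] by (auto simp: \<psi>'_def l scaleR_diff_right)
    qed
    have bd: "norm (\<psi>' r) \<le> 2 * (e' * (t * M))" if r: "r \<in> {0..t}" for r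
    proof -
      \<comment> \<open>Both values of \<open>f' _ a\<close> are expanded around \<open>x\<close>,
        where \<open>Da\<close> is the derivative; the linear parts differ by exactly
        \<open>t *\<^sub>R Da b\<close>.\<close>
      have "\<psi>' r = (f' (x + r *\<^sub>R a + t *\<^sub>R b) a - f' x a - Da (r *\<^sub>R a + t *\<^sub>R b))
          - (f' (x + r *\<^sub>R a + 0 *\<^sub>R b) a - f' x a - Da (r *\<^sub>R a + 0 *\<^sub>R b))"
        by (simp add: \<psi>'_def Da.add Da.scaleR)
      also have "norm \<dots> \<le> e' * (t * M) + e' * (t * M)"
        using r t by (intro order_trans[OF norm_triangle_ineq4 add_mono] approx) auto
      finally show ?thesis by (simp only: mult_2)
    qed
    have "norm (\<psi> t - \<psi> 0) \<le> 2 * (e' * (t * M)) * norm (t - 0)"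
    proof (rule differentiable_bound[OF _ der])
      show "onorm (\<lambda>h. h *\<^sub>R \<psi>' r) \<le> 2 * (e' * (t * M))" if "r \<in> {0..t}" for r
        using bd[OF that] by (intro onorm_le) (simp add: mult.commute mult_left_mono)
    qed (use t in auto)
    also have "\<dots> = e * (t * t)" using t M by (simp add: e'_def field_simps)
    finally show ?thesis by (simp add: \<psi>_def algebra_simps)
  qed
  ultimately show ?thesis by blast
qed

text \<open>The second difference is symmetric in \<open>a\<close> and \<open>b\<close>, and up to
  o(t^2) it is both \<open>t * t\<close> times \<open>Da b\<close> and \<open>t * t\<close> times
  \<open>Db a\<close>. Differentiability of the directional derivatives is the form in which
  \<open>C_k_on\<close> provides smoothness for basis vectors.\<close>

lemma second_derivative_symmetric:
  fixes f :: "'a::real_normed_vector \<Rightarrow> 'b::real_normed_vector"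
  assumes "open U" "x \<in> U"
    and f': "\<And>y. y \<in> U \<Longrightarrow> (f has_derivative f' y) (at y)"
    and Da: "((\<lambda>y. f' y a) has_derivative Da) (at x)"
    and Db: "((\<lambda>y. f' y b) has_derivative Db) (at x)"
  shows "Da b = Db a"
proof (rule ccontr)
  assume "Da b \<noteq> Db a"
  \<comment> \<open>With a quarter of the gap, the two estimates together bound the gap by half of
    itself.\<close>
  define e where "e = norm (Da b - Db a) / 4"
  have e: "e > 0" using \<open>Da b \<noteq> Db a\<close> by (simp add: e_def)
  define \<Delta> where "\<Delta> t = f (x + t *\<^sub>R a + t *\<^sub>R b) - f (x + t *\<^sub>R a) - f (x + t *\<^sub>R b) + f x" for t
  obtain d1 where d1: "d1 > 0" "\<And>t. 0 < t \<and> t < d1 \<Longrightarrow> norm (\<Delta> t - (t * t) *\<^sub>R Da b) \<le> e * (t * t)"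
    using second_difference_bound[OF assms(1,2) f' Da e, of b] unfolding \<Delta>_def by blast
  obtain d2 where d2: "d2 > 0" "\<And>t. 0 < t \<and> t < d2 \<Longrightarrow> norm (\<Delta> t - (t * t) *\<^sub>R Db a) \<le> e * (t * t)"
    using second_difference_bound[OF assms(1,2) f' Db e, of a] unfolding \<Delta>_def
    by (force simp: algebra_simps)
  define t where "t = min d1 d2 / 2"
  have t: "0 < t" "t < d1" "t < d2" using d1 d2 by (auto simp: t_def)
  have "(t * t) * norm (Da b - Db a) = norm ((t * t) *\<^sub>R (Da b - Db a))" by simp
  also have "(t * t) *\<^sub>R (Da b - Db a) = (\<Delta> t - (t * t) *\<^sub>R Db a) - (\<Delta> t - (t * t) *\<^sub>R Da b)"
    by (simp add: algebra_simps)
  also have "norm \<dots> \<le> e * (t * t) + e * (t * t)"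
    using d1(2) d2(2) t by (intro order_trans[OF norm_triangle_ineq4 add_mono]) auto
  finally have "norm (Da b - Db a) \<le> 2 * e" using t by simp
  then show False using e by (simp add: e_def)
qed

section \<open>Derivatives of functions on the jet bundle\<close>

text \<open>A tangent vector of the jet bundle is itself represented as an element of \<^typ>\<open>('m, 'g) jet\<close>. A
  function is differentiable if it has, along all coordinatewise differentiable curves, a derivative
  that depends linearly on finitely many coordinates of the velocity.\<close>

definition jet_linear :: "(('m::finite, 'g::finite) jet \<Rightarrow> 'b::real_vector) \<Rightarrow> bool" where
  "jet_linear D \<longleftrightarrow> (\<exists>S f g. finite S \<and> linear f \<and> (\<forall>I. linear (g I)) \<and>
     (\<forall>v. D v = f (fst v) + (\<Sum>I\<in>S. g I (snd v I))))"

definition jet_curve ::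
    "(real \<Rightarrow> ('m::finite, 'g::finite) jet) \<Rightarrow> ('m, 'g) jet \<Rightarrow> ('m, 'g) jet \<Rightarrow> bool" where
  "jet_curve \<gamma> j v \<longleftrightarrow> \<gamma> 0 = j \<and> ((\<lambda>t. fst (\<gamma> t)) has_vector_derivative fst v) (at 0) \<and>
     (\<forall>I. ((\<lambda>t. snd (\<gamma> t) I) has_vector_derivative snd v I) (at 0))"

definition has_jet_derivative ::
    "(('m::finite, 'g::finite) jet \<Rightarrow> 'b::real_normed_vector) \<Rightarrow> (('m, 'g) jet \<Rightarrow> 'b) \<Rightarrow>
     ('m, 'g) jet \<Rightarrow> bool" where
  "has_jet_derivative f D j \<longleftrightarrow> jet_linear D \<and>
     (\<forall>\<gamma> v. jet_curve \<gamma> j v \<longrightarrow> ((\<lambda>t. f (\<gamma> t)) has_vector_derivative D v) (at 0))"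

definition unit_jet :: "'m multiset \<Rightarrow> 'g \<Rightarrow> 'm \<Rightarrow> ('m::finite, 'g::finite) jet" where
  "unit_jet I A \<mu> = (0, (\<lambda>_. 0)(I := axis A (axis \<mu> 1)))"

text \<open>The value at a jet of the vector field $d_\mu$.\<close>

definition total_vector :: "'m \<Rightarrow> ('m, 'g) jet \<Rightarrow> ('m::finite, 'g::finite) jet" where
  "total_vector \<mu> j = (axis \<mu> 1, \<lambda>I. snd j (add_mset \<mu> I))"

section \<open>Calculus rules for jet derivatives\<close>

lemma jet_linear_0 [simp]: "jet_linear (\<lambda>_. 0)"
  unfolding jet_linear_def
  by (rule exI[of _ "{}"], rule exI[of _ "\<lambda>_. 0"], rule exI[of _ "\<lambda>_ _. 0"]) (auto intro: linearI)

lemma jet_linear_fst: "linear f \<Longrightarrow> jet_linear (\<lambda>v. f (fst v))"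
  unfolding jet_linear_def
  by (rule exI[of _ "{}"], rule exI[of _ f], rule exI[of _ "\<lambda>_ _. 0"]) (auto intro: linearI)

lemma jet_linear_snd: "linear f \<Longrightarrow> jet_linear (\<lambda>v. f (snd v I))"
  unfolding jet_linear_def
  by (rule exI[of _ "{I}"], rule exI[of _ "\<lambda>_. 0"], rule exI[of _ "\<lambda>_. f"]) (auto intro!: linearI)

lemma jet_linear_add:
  assumes "jet_linear D" "jet_linear D'"
  shows "jet_linear (\<lambda>v. D v + D' v)"
proof -
  obtain S f g where D: "finite S" "linear f" "\<And>I. linear (g I)"
     "\<And>v. D v = f (fst v) + (\<Sum>I\<in>S. g I (snd v I))"
    using assms(1) unfolding jet_linear_def by metis
  obtain S' f' g' where D': "finite S'" "linear f'" "\<And>I. linear (g' I)"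
     "\<And>v. D' v = f' (fst v) + (\<Sum>I\<in>S'. g' I (snd v I))"
    using assms(2) unfolding jet_linear_def by metis
  \<comment> \<open>The two finite sets of multi-indices may differ; each family is extended by zero
    so that one family over the union represents the sum.\<close>
  define G where "G I x = (if I \<in> S then g I x else 0) + (if I \<in> S' then g' I x else 0)" for I x
  have "linear (G I)" for I
    unfolding G_def using D(3) D'(3)
    by (cases "I \<in> S"; cases "I \<in> S'") (auto intro: linear_compose_add linearI)
  moreover have "D v + D' v = (f (fst v) + f' (fst v)) + (\<Sum>I\<in>S \<union> S'. G I (snd v I))" for v
  proof -
    have "(\<Sum>I\<in>S \<union> S'. G I (snd v I)) = (\<Sum>I\<in>S. g I (snd v I)) + (\<Sum>I\<in>S'. g' I (snd v I))"
      unfolding G_def sum.distrib using D(1) D'(1)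
      by (simp add: sum.If_cases Int_absorb1 Int_absorb2)
    then show ?thesis by (simp add: D(4) D'(4))
  qed
  ultimately show ?thesis
    unfolding jet_linear_def using D D'
    by (intro exI[of _ "S \<union> S'"] exI[of _ "\<lambda>x. f x + f' x"] exI[of _ G])
       (auto intro: linear_compose_add)
qed

lemma jet_linear_compose:
  assumes "linear h" "jet_linear D"
  shows "jet_linear (\<lambda>v. h (D v))"
proof -
  obtain S f g where D: "finite S" "linear f" "\<And>I. linear (g I)"
     "\<And>v. D v = f (fst v) + (\<Sum>I\<in>S. g I (snd v I))"
    using assms(2) unfolding jet_linear_def by metis
  show ?thesis
    unfolding jet_linear_def using D assms(1)
    by (intro exI[of _ S] exI[of _ "h \<circ> f"] exI[of _ "\<lambda>I. h \<circ> g I"])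
       (auto intro: linear_compose simp: linear_add linear_sum)
qed

lemma jet_linear_sum: "(\<And>i. i \<in> A \<Longrightarrow> jet_linear (D i)) \<Longrightarrow> jet_linear (\<lambda>v. \<Sum>i\<in>A. D i v)"
  by (induction A rule: infinite_finite_induct) (auto intro: jet_linear_add)

lemma has_jet_derivative_const: "has_jet_derivative (\<lambda>_. a) (\<lambda>_. 0) j"
  by (simp add: has_jet_derivative_def)

lemma has_jet_derivative_linear:
  assumes "bounded_linear h" "has_jet_derivative f D j"
  shows "has_jet_derivative (\<lambda>j. h (f j)) (\<lambda>v. h (D v)) j"
  using assms unfolding has_jet_derivative_def
  by (auto intro: bounded_linear.has_vector_derivative jet_linear_compose bounded_linear.linear)

lemma has_jet_derivative_add:
  assumes "has_jet_derivative f D j" "has_jet_derivative g D' j"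
  shows "has_jet_derivative (\<lambda>j. f j + g j) (\<lambda>v. D v + D' v) j"
  using assms unfolding has_jet_derivative_def
  by (auto intro: has_vector_derivative_add jet_linear_add)

lemma has_jet_derivative_diff:
  assumes "has_jet_derivative f D j" "has_jet_derivative g D' j"
  shows "has_jet_derivative (\<lambda>j. f j - g j) (\<lambda>v. D v - D' v) j"
  using has_jet_derivative_add[OF assms(1)
      has_jet_derivative_linear[OF bounded_linear_minus[OF bounded_linear_ident] assms(2)]]
  by simp

lemma has_jet_derivative_sum:
  assumes "\<And>i. i \<in> A \<Longrightarrow> has_jet_derivative (f i) (D i) j"
  shows "has_jet_derivative (\<lambda>j. \<Sum>i\<in>A. f i j) (\<lambda>v. \<Sum>i\<in>A. D i v) j"
  using assms unfolding has_jet_derivative_def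
  by (auto intro!: has_vector_derivative_sum jet_linear_sum)

lemma has_jet_derivative_bilinear:
  assumes "bounded_bilinear h" "has_jet_derivative f D j" "has_jet_derivative g D' j"
  shows "has_jet_derivative (\<lambda>j. h (f j) (g j)) (\<lambda>v. h (f j) (D' v) + h (D v) (g j)) j"
proof -
  interpret bounded_bilinear h by fact
  have "jet_linear (\<lambda>v. h (f j) (D' v) + h (D v) (g j))"
    using assms(2,3) unfolding has_jet_derivative_def
    by (intro jet_linear_add jet_linear_compose[of "h (f j)"] jet_linear_compose[of "\<lambda>x. h x (g j)"]
          bounded_linear.linear bounded_linear_left bounded_linear_right) auto
  moreover have "((\<lambda>t. h (f (\<gamma> t)) (g (\<gamma> t))) has_vector_derivative h (f j) (D' v) + h (D v) (g j)) (at 0)"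
    if c: "jet_curve \<gamma> j v" for \<gamma> v
  proof -
    have "((\<lambda>t. f (\<gamma> t)) has_vector_derivative D v) (at 0)"
      "((\<lambda>t. g (\<gamma> t)) has_vector_derivative D' v) (at 0)"
      using assms(2,3) c unfolding has_jet_derivative_def by blast+
    from has_vector_derivative[OF this] show ?thesis
      using c by (simp add: jet_curve_def)
  qed
  ultimately show ?thesis by (simp only: has_jet_derivative_def) blast
qed

text \<open>The base component of a curve is continuous at 0, so the curve stays over
  \<open>U\<close> for small parameters. This localisation is required because \<Xi> is smooth over
  \<open>U\<close> only.\<close>

lemma has_jet_derivative_cong:
  assumes "open U" "fst j \<in> U" "\<And>j'. fst j' \<in> U \<Longrightarrow> f j' = g j'" "has_jet_derivative f D j"
  shows "has_jet_derivative g D j"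
  unfolding has_jet_derivative_def
proof (intro conjI allI impI)
  show "jet_linear D" using assms(4) by (simp add: has_jet_derivative_def)
  fix \<gamma> v assume c: "jet_curve \<gamma> j v"
  have "((\<lambda>t. fst (\<gamma> t)) \<longlongrightarrow> fst (\<gamma> 0)) (at 0)"
    using c unfolding jet_curve_def
    by (metis continuous_within has_vector_derivative_continuous)
  moreover have "fst (\<gamma> 0) \<in> U" using c assms(2) by (simp add: jet_curve_def)
  ultimately have ev: "\<forall>\<^sub>F t in at 0. f (\<gamma> t) = g (\<gamma> t)"
    using assms(1,3) topological_tendstoD by (smt (verit) eventually_mono)
  have "((\<lambda>t. f (\<gamma> t)) has_vector_derivative D v) (at 0)"
    using assms(4) c unfolding has_jet_derivative_def by blast
  moreover have "f (\<gamma> 0) = g (\<gamma> 0)" using \<open>fst (\<gamma> 0) \<in> U\<close> assms(3) by blast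
  ultimately show "((\<lambda>t. g (\<gamma> t)) has_vector_derivative D v) (at 0)"
    using ev unfolding has_vector_derivative_def
    by (elim has_derivative_transform_eventually) auto
qed

section \<open>Coordinate and total derivatives as values of the jet derivative\<close>

lemma jet_curve_dx: "jet_curve (\<lambda>t. (fst j + t *\<^sub>R axis \<mu> 1, snd j)) j (axis \<mu> 1, \<lambda>_. 0)"
  unfolding jet_curve_def by (auto intro!: derivative_eq_intros)

lemma jet_curve_du:
  "jet_curve (\<lambda>t. (fst j, (snd j)(I := snd j I + t *\<^sub>R axis A (axis \<mu> 1)))) j (unit_jet I A \<mu>)"
  unfolding jet_curve_def unit_jet_def by (auto intro!: derivative_eq_intros)

lemma dx_eq:
  assumes "has_jet_derivative f D j"
  shows "dx \<mu> f j = D (axis \<mu> 1, \<lambda>_. 0)"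
proof -
  have "((\<lambda>t. f (fst j + t *\<^sub>R axis \<mu> 1, snd j)) has_vector_derivative D (axis \<mu> 1, \<lambda>_. 0)) (at 0)"
    using assms jet_curve_dx[of j \<mu>] unfolding has_jet_derivative_def by blast
  then show ?thesis
    by (simp add: dx_def case_prod_beta DERIV_imp_deriv has_real_derivative_iff_has_vector_derivative)
qed

lemma du_eq:
  assumes "has_jet_derivative f D j"
  shows "du I A \<mu> f j = D (unit_jet I A \<mu>)"
proof -
  have "((\<lambda>t. f (fst j, (snd j)(I := snd j I + t *\<^sub>R axis A (axis \<mu> 1))))
      has_vector_derivative D (unit_jet I A \<mu>)) (at 0)"
    using assms jet_curve_du[of j I A \<mu>] unfolding has_jet_derivative_def by blast
  then show ?thesis
    by (simp add: du_def case_prod_beta DERIV_imp_deriv has_real_derivative_iff_has_vector_derivative)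
qed

lemma pot_expansion: "(u :: ('m::finite, 'g::finite) pot) = (\<Sum>A\<in>UNIV. \<Sum>\<sigma>\<in>UNIV. u $ A $ \<sigma> *\<^sub>R axis A (axis \<sigma> 1))"
proof -
  have "(u $ A $ \<sigma> *\<^sub>R axis A (axis \<sigma> 1)) $ B $ \<tau> = (if A = B then if \<sigma> = \<tau> then u $ A $ \<sigma> else 0 else 0)"
    for A B \<sigma> \<tau>
    by (auto simp: axis_def)
  moreover have "(\<Sum>\<sigma>\<in>UNIV. if A = B then if \<sigma> = \<tau> then u $ A $ \<sigma> else 0 else 0)
      = (if A = B then u $ A $ \<tau> else 0)" for A B \<tau>
    by simp
  ultimately show ?thesis
    by (simp only: vec_eq_iff sum_component) simp
qed

text \<open>The finite set in \<open>jet_linear\<close> contains the support of the family, so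
  \<open>Sum_any\<close> is a genuine finite sum, and linearity assembles the partial derivatives
  into the value on the vector field. From here on, total derivatives are computed by the product
  and chain rules.\<close>

lemma total_deriv_eq:
  assumes "has_jet_derivative f D j"
  shows "total_deriv \<mu> f j = D (total_vector \<mu> j)"
proof -
  obtain S F g where D: "finite S" "linear F" "\<And>I. linear (g I)"
     "\<And>v. D v = F (fst v) + (\<Sum>I\<in>S. g I (snd v I))"
    using assms(1) unfolding has_jet_derivative_def jet_linear_def by metis
  have du: "du I A \<sigma> f j = (if I \<in> S then g I (axis A (axis \<sigma> 1)) else 0)" for I A \<sigma>
  proof -
    have "(\<Sum>I'\<in>S. g I' (((\<lambda>_. 0)(I := axis A (axis \<sigma> 1))) I'))
        = (\<Sum>I'\<in>S. if I' = I then g I (axis A (axis \<sigma> 1)) else 0)"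
      by (rule sum.cong) (auto simp: linear_0 D)
    then show ?thesis
      unfolding du_eq[OF assms] D(4) unit_jet_def using D(1) by (simp add: linear_0[OF D(2)])
  qed
  have "Sum_any (\<lambda>I. \<Sum>A\<in>UNIV. \<Sum>\<sigma>\<in>UNIV. snd j (add_mset \<mu> I) $ A $ \<sigma> * du I A \<sigma> f j)
      = (\<Sum>I\<in>S. \<Sum>A\<in>UNIV. \<Sum>\<sigma>\<in>UNIV. snd j (add_mset \<mu> I) $ A $ \<sigma> * du I A \<sigma> f j)"
  proof (rule Sum_any.expand_superset[OF D(1)], rule subsetI, rule ccontr)
    fix I assume "I \<in> {I. (\<Sum>A\<in>UNIV. \<Sum>\<sigma>\<in>UNIV. snd j (add_mset \<mu> I) $ A $ \<sigma> * du I A \<sigma> f j) \<noteq> 0}" "I \<notin> S"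
    then show False by (simp add: du)
  qed
  also have "\<dots> = (\<Sum>I\<in>S. g I (snd j (add_mset \<mu> I)))"
  proof (rule sum.cong[OF refl])
    fix I assume "I \<in> S"
    have "g I (snd j (add_mset \<mu> I))
        = g I (\<Sum>A\<in>UNIV. \<Sum>\<sigma>\<in>UNIV. snd j (add_mset \<mu> I) $ A $ \<sigma> *\<^sub>R axis A (axis \<sigma> 1))"
      by (rule arg_cong[OF pot_expansion])
    also have "\<dots> = (\<Sum>A\<in>UNIV. \<Sum>\<sigma>\<in>UNIV. snd j (add_mset \<mu> I) $ A $ \<sigma> * du I A \<sigma> f j)"
      using \<open>I \<in> S\<close> by (simp only: linear_sum[OF D(3)] linear_cmul[OF D(3)] du real_scaleR_def if_True)
    finally show "(\<Sum>A\<in>UNIV. \<Sum>\<sigma>\<in>UNIV. snd j (add_mset \<mu> I) $ A $ \<sigma> * du I A \<sigma> f j)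
        = g I (snd j (add_mset \<mu> I))" ..
  qed
  finally show ?thesis
    by (simp add: total_deriv_def dx_eq[OF assms] D(4) total_vector_def linear_0[OF D(3)])
qed

section \<open>Jet coordinates\<close>

definition pot_column :: "'m \<Rightarrow> ('m::finite, 'g::finite) pot \<Rightarrow> real^'g" where
  "pot_column \<mu> u = (\<chi> A. u $ A $ \<mu>)"

definition jet_coord :: "'m multiset \<Rightarrow> 'm \<Rightarrow> ('m::finite, 'g::finite) jet \<Rightarrow> real^'g" where
  "jet_coord I \<mu> j = pot_column \<mu> (snd j I)"

lemma bounded_linear_pot_column: "bounded_linear (pot_column \<mu>)"
  unfolding linear_conv_bounded_linear[symmetric] pot_column_def
  by (rule linearI) (simp_all add: vec_eq_iff)

lemma pot_column_0 [simp]: "pot_column \<mu> 0 = 0"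
  by (simp add: pot_column_def vec_eq_iff)

lemma has_jet_derivative_snd: "has_jet_derivative (\<lambda>j. snd j I) (\<lambda>v. snd v I) j"
  unfolding has_jet_derivative_def jet_curve_def by (auto intro: jet_linear_snd[OF linear_id[unfolded id_def]])

lemma has_jet_derivative_coord: "has_jet_derivative (jet_coord I \<mu>) (jet_coord I \<mu>) j"
  unfolding jet_coord_def
  by (rule has_jet_derivative_linear[OF bounded_linear_pot_column has_jet_derivative_snd])

lemma jet_coord_unit [simp]:
  "jet_coord I \<mu> (unit_jet I' C \<nu>) = (if I = I' \<and> \<mu> = \<nu> then axis C 1 else 0)"
  by (auto simp: jet_coord_def unit_jet_def pot_column_def vec_eq_iff axis_def)

lemma jet_coord_total_vector [simp]:
  "jet_coord I \<mu> (total_vector \<alpha> j) = jet_coord (add_mset \<alpha> I) \<mu> j"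
  by (simp add: jet_coord_def total_vector_def)

lemma has_jet_derivative_cmult:
  fixes f :: "('m::finite, 'g::finite) jet \<Rightarrow> real"
  assumes "has_jet_derivative f D j"
  shows "has_jet_derivative (\<lambda>j. a * f j) (\<lambda>v. a * D v) j"
  by (rule has_jet_derivative_linear[OF bounded_linear_mult_right assms])

lemma has_jet_derivative_nth:
  assumes "has_jet_derivative f D j"
  shows "has_jet_derivative (\<lambda>j. f j $ A) (\<lambda>v. D v $ A) j"
  by (rule has_jet_derivative_linear[OF bounded_linear_vec_nth assms])

text \<open>Agreement on all jets over \<open>U\<close> makes the rule iterable: a first total
  derivative is itself known by a formula only there.\<close>

lemma total_deriv_cong:
  assumes "open U" "fst j \<in> U" "\<And>j'. fst j' \<in> U \<Longrightarrow> g j' = f j'" "has_jet_derivative f D j"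
  shows "total_deriv \<mu> g j = D (total_vector \<mu> j)"
  by (rule total_deriv_eq, rule has_jet_derivative_cong[OF assms(1,2) _ assms(4)])
    (simp add: assms(3))

lemma total_deriv_multi_eq_0:
  assumes "open U" "\<And>j. fst j \<in> U \<Longrightarrow> f j = 0" "fst j \<in> U"
  shows "total_deriv_multi I f j = 0"
proof -
  have "foldr total_deriv xs f j = 0" if "fst j \<in> U" for xs j
    using that
  proof (induction xs arbitrary: j)
    case (Cons \<mu> xs)
    then show ?case
      using total_deriv_cong[OF assms(1) Cons.prems _ has_jet_derivative_const[of 0]] by simp
  qed (simp add: assms(2))
  then show ?thesis using assms(3) by (simp add: total_deriv_multi_def)
qed

lemma total_deriv_multi_empty [simp]: "total_deriv_multi {#} f = f"
  by (simp add: total_deriv_multi_def)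

lemma total_deriv_multi_single [simp]: "total_deriv_multi {#\<mu>#} f = total_deriv \<mu> f"
  by (simp add: total_deriv_multi_def)

text \<open>Which order occurs depends on the linear order of the indices. Leaving \<open>a\<close>
  and \<open>b\<close> unspecified postpones the matter until \<open>field2_commute\<close> makes it
  irrelevant.\<close>

lemma total_deriv_multi_pair:
  "\<exists>a b. {#a, b#} = {#\<mu>, \<nu>#} \<and> total_deriv_multi {#\<mu>, \<nu>#} f = total_deriv a (total_deriv b f)"
proof (cases "\<mu> \<le> \<nu>")
  case True
  then show ?thesis
    by (intro exI[of _ \<mu>] exI[of _ \<nu>]) (simp add: total_deriv_multi_def insort_is_Cons)
next
  case False
  then show ?thesis
    by (intro exI[of _ \<nu>] exI[of _ \<mu>]) (simp add: total_deriv_multi_def add_mset_commute)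
qed


section \<open>Vertical vector fields\<close>

locale smooth_vertical_field =
  fixes U :: "'m::finite base set"
    and \<Xi> :: "'m base \<times> ('m, 'g::finite) pot \<Rightarrow> ('m, 'g) pot"
  assumes open_U: "open U" and smooth: "smooth_map_on \<Xi> (U \<times> UNIV)"
begin

abbreviation point :: "('m, 'g) jet \<Rightarrow> 'm base \<times> ('m, 'g) pot" where
  "point j \<equiv> (fst j, snd j {#})"

text \<open>The direction precedes the point so that \<open>\<Xi>d e\<close> is again a function on
  the bundle, to be differentiated once more as in \<open>C_k_on\<close>.\<close>

definition \<Xi>d :: "'m base \<times> ('m, 'g) pot \<Rightarrow> 'm base \<times> ('m, 'g) pot \<Rightarrow> ('m, 'g) pot" where
  "\<Xi>d e p = frechet_derivative \<Xi> (at p) e"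

definition \<Xi>dd :: "'m base \<times> ('m, 'g) pot \<Rightarrow> 'm base \<times> ('m, 'g) pot \<Rightarrow>
    'm base \<times> ('m, 'g) pot \<Rightarrow> ('m, 'g) pot" where
  "\<Xi>dd e e' p = frechet_derivative (\<Xi>d e) (at p) e'"

text \<open>The projection of the vector field d_\<alpha> from the jet bundle to the bundle of
  connections.\<close>

definition direction :: "'m \<Rightarrow> ('m, 'g) jet \<Rightarrow> 'm base \<times> ('m, 'g) pot" where
  "direction \<alpha> j = point (total_vector \<alpha> j)"

definition field :: "'m \<Rightarrow> ('m, 'g) jet \<Rightarrow> real^'g" where
  "field \<nu> j = pot_column \<nu> (\<Xi> (point j))"

definition field_jet :: "'m \<Rightarrow> ('m, 'g) jet \<Rightarrow> ('m, 'g) jet \<Rightarrow> real^'g" where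
  "field_jet \<nu> j v = pot_column \<nu> (\<Xi>d (point v) (point j))"

text \<open>Over \<open>U\<close> this is d_\<alpha> \<Xi>_\<nu> as a Lie algebra vector;
  \<open>field2 \<beta> \<alpha> \<nu>\<close> is likewise d_\<beta> d_\<alpha> \<Xi>_\<nu>.\<close>

definition field1 :: "'m \<Rightarrow> 'm \<Rightarrow> ('m, 'g) jet \<Rightarrow> real^'g" where
  "field1 \<alpha> \<nu> j = pot_column \<nu> (\<Xi>d (direction \<alpha> j) (point j))"

text \<open>\<open>\<Xi>d e\<close> is known to be differentiable for basis vectors
  \<open>e\<close>, while \<open>direction \<alpha> j\<close> varies with the jet. Hence
  \<open>field1\<close> is expanded over \<open>Basis\<close> and the product rule is applied. The
  base component of \<open>direction\<close> is constant, which explains the 0 in the last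
  summand.\<close>

definition field1_jet :: "'m \<Rightarrow> 'm \<Rightarrow> ('m, 'g) jet \<Rightarrow> ('m, 'g) jet \<Rightarrow> real^'g" where
  "field1_jet \<alpha> \<nu> j v = pot_column \<nu> (\<Sum>e\<in>Basis. (direction \<alpha> j \<bullet> e) *\<^sub>R \<Xi>dd e (point v) (point j)
      + ((0, snd v {#\<alpha>#}) \<bullet> e) *\<^sub>R \<Xi>d e (point j))"

definition field2 :: "'m \<Rightarrow> 'm \<Rightarrow> 'm \<Rightarrow> ('m, 'g) jet \<Rightarrow> real^'g" where
  "field2 \<beta> \<alpha> \<nu> j = field1_jet \<alpha> \<nu> j (total_vector \<beta> j)"

lemma vf_comp_field: "vf_comp \<Xi> Z \<nu> j = field \<nu> j $ Z"
  by (simp add: vf_comp_def field_def pot_column_def)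

lemma open_domain: "open (U \<times> (UNIV :: ('m, 'g) pot set))"
  using open_U by (simp add: open_Times)

lemma \<Xi>_has_derivative:
  assumes "p \<in> U \<times> UNIV"
  shows "(\<Xi> has_derivative (\<lambda>e. \<Xi>d e p)) (at p)"
proof -
  have "C_k_on (Suc 0) \<Xi> (U \<times> UNIV)" using smooth by (simp only: smooth_map_on_def)
  then have "\<Xi> differentiable_on (U \<times> UNIV)" by simp
  then have "\<Xi> differentiable (at p)"
    using assms(1) open_domain differentiable_on_eq_differentiable_at by blast
  then show ?thesis unfolding \<Xi>d_def by (simp add: frechet_derivative_works)
qed

lemma \<Xi>d_has_derivative:
  assumes "p \<in> U \<times> UNIV" "e \<in> Basis"
  shows "(\<Xi>d e has_derivative (\<lambda>e'. \<Xi>dd e e' p)) (at p)"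
proof -
  have "C_k_on (Suc (Suc 0)) \<Xi> (U \<times> UNIV)" using smooth by (simp only: smooth_map_on_def)
  then have "C_k_on (Suc 0) (\<lambda>x. frechet_derivative \<Xi> (at x) e) (U \<times> UNIV)"
    using assms(2) by (simp only: C_k_on.simps) blast
  then have "\<Xi>d e differentiable_on (U \<times> UNIV)"
    unfolding \<Xi>d_def[abs_def] by (simp only: C_k_on.simps)
  then have "\<Xi>d e differentiable (at p)"
    using assms(1) open_domain differentiable_on_eq_differentiable_at by blast
  then show ?thesis unfolding \<Xi>dd_def by (simp add: frechet_derivative_works)
qed

lemma \<Xi>dd_symmetric:
  assumes "p \<in> U \<times> UNIV" "e \<in> Basis" "e' \<in> Basis"
  shows "\<Xi>dd e e' p = \<Xi>dd e' e p"
  by (rule second_derivative_symmetric[OF open_domain assms(1) \<Xi>_has_derivative])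
    (use assms in \<open>auto intro: \<Xi>d_has_derivative\<close>)

lemma has_jet_derivative_point_compose:
  assumes "(\<Phi> has_derivative \<Phi>') (at (point j))"
  shows "has_jet_derivative (\<lambda>j. \<Phi> (point j)) (\<lambda>v. \<Phi>' (point v)) j"
  unfolding has_jet_derivative_def
proof (intro conjI allI impI)
  have l: "linear \<Phi>'" using assms by (rule has_derivative_linear)
  \<comment> \<open>Base and fibre part are separated to reach the shape demanded by
    \<open>jet_linear\<close>.\<close>
  have "\<Phi>' (point v) = \<Phi>' (fst v, 0) + \<Phi>' (0, snd v {#})" for v
    using linear_add[OF l, of "(fst v, 0)" "(0, snd v {#})"] by simp
  moreover have "linear (\<lambda>x. \<Phi>' (x, 0))" "linear (\<lambda>u. \<Phi>' (0, u))"
    using linear_add[OF l] linear_cmul[OF l]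
    by (auto intro!: linearI simp flip: linear_add[OF l] linear_cmul[OF l])
  ultimately show "jet_linear (\<lambda>v. \<Phi>' (point v))"
    by (simp only:) (intro jet_linear_add jet_linear_fst[of "\<lambda>x. \<Phi>' (x, 0)"] jet_linear_snd[of "\<lambda>u. \<Phi>' (0, u)"])
  fix \<gamma> v assume "jet_curve \<gamma> j v"
  then have "((\<lambda>t. point (\<gamma> t)) has_vector_derivative point v) (at 0)" "point (\<gamma> 0) = point j"
    by (auto simp: jet_curve_def intro: has_vector_derivative_Pair)
  then show "((\<lambda>t. \<Phi> (point (\<gamma> t))) has_vector_derivative \<Phi>' (point v)) (at 0)"
    using has_derivative_compose[of "\<lambda>t. point (\<gamma> t)" "\<lambda>h. h *\<^sub>R point v" 0 UNIV \<Phi> \<Phi>'] assms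
    by (simp add: has_vector_derivative_def linear_cmul[OF l, symmetric])
qed

lemma field_has_jet_derivative:
  assumes "fst j \<in> U"
  shows "has_jet_derivative (field \<nu>) (field_jet \<nu> j) j"
  unfolding field_def field_jet_def
  using assms
  by (intro has_jet_derivative_linear[OF bounded_linear_pot_column]
        has_jet_derivative_point_compose[OF \<Xi>_has_derivative]) auto

lemma \<Xi>d_expansion:
  assumes "p \<in> U \<times> UNIV"
  shows "\<Xi>d w p = (\<Sum>e\<in>Basis. (w \<bullet> e) *\<^sub>R \<Xi>d e p)"
proof -
  have l: "linear (\<lambda>e. \<Xi>d e p)" using \<Xi>_has_derivative[OF assms] by (rule has_derivative_linear)
  have "\<Xi>d w p = \<Xi>d (\<Sum>e\<in>Basis. (w \<bullet> e) *\<^sub>R e) p" by (simp add: euclidean_representation)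
  then show ?thesis by (simp only: linear_sum[OF l] linear_cmul[OF l])
qed

lemma \<Xi>dd_expansion:
  assumes "p \<in> U \<times> UNIV" "e \<in> Basis"
  shows "\<Xi>dd e w p = (\<Sum>e'\<in>Basis. (w \<bullet> e') *\<^sub>R \<Xi>dd e e' p)"
proof -
  have l: "linear (\<lambda>e'. \<Xi>dd e e' p)" using \<Xi>d_has_derivative[OF assms] by (rule has_derivative_linear)
  have "\<Xi>dd e w p = \<Xi>dd e (\<Sum>e\<in>Basis. (w \<bullet> e) *\<^sub>R e) p" by (simp add: euclidean_representation)
  then show ?thesis by (simp only: linear_sum[OF l] linear_cmul[OF l])
qed

lemma has_jet_derivative_direction:
  "has_jet_derivative (\<lambda>j. direction \<alpha> j \<bullet> e) (\<lambda>v. (0, snd v {#\<alpha>#}) \<bullet> e) j"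
proof -
  have "has_jet_derivative (\<lambda>j. axis \<alpha> 1 \<bullet> fst e + snd j {#\<alpha>#} \<bullet> snd e)
      (\<lambda>v. 0 + snd v {#\<alpha>#} \<bullet> snd e) j"
    by (intro has_jet_derivative_add has_jet_derivative_const
          has_jet_derivative_linear[OF bounded_linear_inner_left has_jet_derivative_snd])
  then show ?thesis by (simp add: direction_def total_vector_def inner_prod_def)
qed

lemma field1_has_jet_derivative:
  assumes "fst j \<in> U"
  shows "has_jet_derivative (field1 \<alpha> \<nu>) (field1_jet \<alpha> \<nu> j) j"
proof -
  have "has_jet_derivative
      (\<lambda>j. pot_column \<nu> (\<Sum>e\<in>Basis. (direction \<alpha> j \<bullet> e) *\<^sub>R \<Xi>d e (point j))) (field1_jet \<alpha> \<nu> j) j"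
    unfolding field1_jet_def
    using assms
    by (intro has_jet_derivative_linear[OF bounded_linear_pot_column] has_jet_derivative_sum
          has_jet_derivative_bilinear[OF bounded_bilinear_scaleR] has_jet_derivative_direction
          has_jet_derivative_point_compose[OF \<Xi>d_has_derivative]) auto
  then show ?thesis
    by (rule has_jet_derivative_cong[OF open_U assms, rotated])
      (simp add: field1_def \<Xi>d_expansion[of _ "direction \<alpha> _"])
qed

lemma field_jet_total_vector: "field_jet \<nu> j (total_vector \<alpha> j) = field1 \<alpha> \<nu> j"
  by (simp add: field_jet_def field1_def direction_def)

text \<open>Second derivatives of \<Xi> contribute a symmetric expression, and the remaining part
  contains the directions only through the second-order jet coordinate, whose multi-index is a
  multiset.\<close>

lemma field2_commute:
  assumes "fst j \<in> U"
  shows "field2 \<beta> \<alpha> \<nu> j = field2 \<alpha> \<beta> \<nu> j"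
proof -
  let ?p = "point j"
  have p: "?p \<in> U \<times> UNIV" using assms by simp
  have expand: "(\<Sum>e\<in>Basis. (direction \<alpha> j \<bullet> e) *\<^sub>R \<Xi>dd e (direction \<beta> j) ?p)
      = (\<Sum>e\<in>Basis. \<Sum>e'\<in>Basis. (direction \<alpha> j \<bullet> e) *\<^sub>R (direction \<beta> j \<bullet> e') *\<^sub>R \<Xi>dd e e' ?p)" for \<alpha> \<beta>
    by (rule sum.cong[OF refl], subst \<Xi>dd_expansion[OF p]) (simp_all add: scaleR_sum_right)
  have swap: "(\<Sum>e\<in>Basis. \<Sum>e'\<in>Basis. (direction \<alpha> j \<bullet> e) *\<^sub>R (direction \<beta> j \<bullet> e') *\<^sub>R \<Xi>dd e e' ?p)
      = (\<Sum>e\<in>Basis. \<Sum>e'\<in>Basis. (direction \<beta> j \<bullet> e) *\<^sub>R (direction \<alpha> j \<bullet> e') *\<^sub>R \<Xi>dd e e' ?p)"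
    by (subst sum.swap, intro sum.cong refl) (simp add: \<Xi>dd_symmetric[OF p] mult.commute)
  have "(\<Sum>e\<in>Basis. (direction \<alpha> j \<bullet> e) *\<^sub>R \<Xi>dd e (direction \<beta> j) ?p)
      = (\<Sum>e\<in>Basis. (direction \<beta> j \<bullet> e) *\<^sub>R \<Xi>dd e (direction \<alpha> j) ?p)"
    by (simp only: expand swap)
  moreover have "snd (total_vector \<beta> j) {#\<alpha>#} = snd (total_vector \<alpha> j) {#\<beta>#}"
    by (simp add: total_vector_def add_mset_commute)
  ultimately show ?thesis
    by (simp only: field2_def field1_jet_def sum.distrib direction_def[symmetric])
qed

lemma field_jet_unit:
  assumes "fst j \<in> U" "I \<noteq> {#}"
  shows "field_jet \<nu> j (unit_jet I C \<kappa>) = 0"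
proof -
  have "linear (\<lambda>e. \<Xi>d e (point j))"
    using assms by (intro has_derivative_linear[OF \<Xi>_has_derivative]) auto
  then have "\<Xi>d 0 (point j) = 0" by (rule linear_0)
  then show ?thesis
    using assms(2) by (simp add: field_jet_def unit_jet_def zero_prod_def)
qed

end

section \<open>The Yang-Mills equations in terms of bracket and metric\<close>

definition lie_bracket :: "('g \<Rightarrow> 'g \<Rightarrow> 'g \<Rightarrow> real) \<Rightarrow> real^'g \<Rightarrow> real^'g \<Rightarrow> real^'g::finite" where
  "lie_bracket c X Y = (\<chi> A. \<Sum>B\<in>UNIV. \<Sum>C\<in>UNIV. c A B C * X $ B * Y $ C)"

definition metric_form :: "('g \<Rightarrow> 'g \<Rightarrow> real) \<Rightarrow> real^'g \<Rightarrow> real^'g::finite \<Rightarrow> real" where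
  "metric_form \<delta> X Y = (\<Sum>A\<in>UNIV. \<Sum>B\<in>UNIV. \<delta> A B * X $ A * Y $ B)"

lemma bounded_bilinear_lie_bracket: "bounded_bilinear (lie_bracket c)"
  unfolding bilinear_conv_bounded_bilinear[symmetric] bilinear_def lie_bracket_def
  by (auto intro!: linearI simp: vec_eq_iff algebra_simps sum.distrib sum_distrib_left)

lemma bounded_bilinear_metric_form: "bounded_bilinear (metric_form \<delta>)"
  unfolding bilinear_conv_bounded_bilinear[symmetric] bilinear_def metric_form_def
  by (auto intro!: linearI simp: algebra_simps sum.distrib sum_distrib_left)

lemma sum_if_const:
  "(\<Sum>x\<in>A. if P then f x else 0) = (if P then \<Sum>x\<in>A. f x else (0::real))"
  by simp

locale yang_mills_jets =
  fixes c :: "'g::finite \<Rightarrow> 'g \<Rightarrow> 'g \<Rightarrow> real"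
    and \<delta> :: "'g \<Rightarrow> 'g \<Rightarrow> real"
    and h :: "'m::{finite,linorder} metric"
  assumes c_antisym: "c A C B = - c A B C"
    and \<delta>_sym: "\<delta> B A = \<delta> A B"
    and h_diag: "\<mu> \<noteq> \<nu> \<Longrightarrow> h $ \<mu> $ \<nu> = 0"
begin

definition lie :: "real^'g \<Rightarrow> real^'g \<Rightarrow> real^'g" where "lie = lie_bracket c"

definition ip :: "real^'g \<Rightarrow> real^'g \<Rightarrow> real" where "ip = metric_form \<delta>"

definition k :: "'m \<Rightarrow> 'm \<Rightarrow> real" where "k \<mu> \<nu> = h $ \<mu> $ \<mu> * h $ \<nu> $ \<nu>"

sublocale lie: bounded_bilinear lie
  unfolding lie_def by (rule bounded_bilinear_lie_bracket)

sublocale ip: bounded_bilinear ip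
  unfolding ip_def by (rule bounded_bilinear_metric_form)

lemma lie_antisym: "lie X Y = - lie Y X"
proof -
  have "(\<Sum>B\<in>UNIV. \<Sum>C\<in>UNIV. c A B C * X $ B * Y $ C) = (\<Sum>B\<in>UNIV. \<Sum>C\<in>UNIV. - (c A B C * Y $ B * X $ C))" for A
    by (subst sum.swap, intro sum.cong refl, subst c_antisym) simp
  then show ?thesis by (simp add: lie_def lie_bracket_def vec_eq_iff sum_negf)
qed

lemma ip_sym: "ip X Y = ip Y X"
  unfolding ip_def metric_form_def
  by (subst sum.swap, intro sum.cong refl, subst \<delta>_sym) simp

lemma k_sym: "k \<mu> \<nu> = k \<nu> \<mu>"
  by (simp add: k_def)

lemma h_sum: "(\<Sum>\<sigma>\<in>UNIV. h $ \<nu> $ \<sigma> * f \<sigma>) = h $ \<nu> $ \<nu> * f \<nu>"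
proof -
  have "(\<Sum>\<sigma>\<in>UNIV. h $ \<nu> $ \<sigma> * f \<sigma>) = (\<Sum>\<sigma>\<in>{\<nu>}. h $ \<nu> $ \<sigma> * f \<sigma>)"
    by (rule sum.mono_neutral_right) (auto simp: h_diag)
  then show ?thesis by simp
qed

definition curv :: "'m \<Rightarrow> 'm \<Rightarrow> ('m, 'g) jet \<Rightarrow> real^'g" where
  "curv \<mu> \<nu> j = jet_coord {#\<mu>#} \<nu> j - jet_coord {#\<nu>#} \<mu> j
     + lie (jet_coord {#} \<mu> j) (jet_coord {#} \<nu> j)"

definition curv_jet :: "'m \<Rightarrow> 'm \<Rightarrow> ('m, 'g) jet \<Rightarrow> ('m, 'g) jet \<Rightarrow> real^'g" where
  "curv_jet \<mu> \<nu> j v = jet_coord {#\<mu>#} \<nu> v - jet_coord {#\<nu>#} \<mu> v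
     + (lie (jet_coord {#} \<mu> j) (jet_coord {#} \<nu> v) + lie (jet_coord {#} \<mu> v) (jet_coord {#} \<nu> j))"

text \<open>The total derivative d_\<mu> of F_{\<mu>\<nu>}, with \<mu> repeated: for a diagonal
  metric the divergence of F pairs the derivative only with an equal first index.\<close>

definition dcurv :: "'m \<Rightarrow> 'm \<Rightarrow> ('m, 'g) jet \<Rightarrow> real^'g" where
  "dcurv \<mu> \<nu> j = jet_coord {#\<mu>, \<mu>#} \<nu> j - jet_coord {#\<mu>, \<nu>#} \<mu> j
     + (lie (jet_coord {#} \<mu> j) (jet_coord {#\<mu>#} \<nu> j) + lie (jet_coord {#\<mu>#} \<mu> j) (jet_coord {#} \<nu> j))"

definition dcurv_jet :: "'m \<Rightarrow> 'm \<Rightarrow> ('m, 'g) jet \<Rightarrow> ('m, 'g) jet \<Rightarrow> real^'g" where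
  "dcurv_jet \<mu> \<nu> j v = jet_coord {#\<mu>, \<mu>#} \<nu> v - jet_coord {#\<mu>, \<nu>#} \<mu> v
     + ((lie (jet_coord {#} \<mu> j) (jet_coord {#\<mu>#} \<nu> v) + lie (jet_coord {#} \<mu> v) (jet_coord {#\<mu>#} \<nu> j))
     + (lie (jet_coord {#\<mu>#} \<mu> j) (jet_coord {#} \<nu> v) + lie (jet_coord {#\<mu>#} \<mu> v) (jet_coord {#} \<nu> j)))"

lemmas has_jet_derivative_lie = has_jet_derivative_bilinear[OF lie.bounded_bilinear_axioms]
lemmas has_jet_derivative_ip = has_jet_derivative_bilinear[OF ip.bounded_bilinear_axioms]

lemma curv_has_jet_derivative: "has_jet_derivative (curv \<mu> \<nu>) (curv_jet \<mu> \<nu> j) j"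
  unfolding curv_def curv_jet_def
  by (intro has_jet_derivative_add has_jet_derivative_diff has_jet_derivative_lie
      has_jet_derivative_coord)

lemma dcurv_has_jet_derivative: "has_jet_derivative (dcurv \<mu> \<nu>) (dcurv_jet \<mu> \<nu> j) j"
  unfolding dcurv_def dcurv_jet_def
  by (intro has_jet_derivative_add has_jet_derivative_diff has_jet_derivative_lie
      has_jet_derivative_coord)

lemma curv_jet_total_vector: "curv_jet \<mu> \<nu> j (total_vector \<mu> j) = dcurv \<mu> \<nu> j"
  by (simp add: curv_jet_def dcurv_def)

lemma curv_antisym: "curv \<mu> \<nu> j = - curv \<nu> \<mu> j"
  using lie_antisym[of "jet_coord {#} \<mu> j"] by (simp add: curv_def)

lemma field_strength_curv: "field_strength c A \<mu> \<nu> j = curv \<mu> \<nu> j $ A"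
  by (simp add: field_strength_def curv_def lie_def lie_bracket_def jet_coord_def pot_column_def
      conn_def conn_d_def)

lemma conn_jet_coord: "conn A \<mu> j = jet_coord {#} \<mu> j $ A"
  by (simp add: conn_def jet_coord_def pot_column_def)

lemma yang_mills_eq:
  "yang_mills c \<delta> h = (\<lambda>j. - (1/4) * (\<Sum>\<mu>\<in>UNIV. \<Sum>\<nu>\<in>UNIV. k \<mu> \<nu> * ip (curv \<mu> \<nu> j) (curv \<mu> \<nu> j)))"
proof
  fix j :: "('m, 'g) jet"
  let ?F = "\<lambda>A \<mu> \<nu>. field_strength c A \<mu> \<nu> j"
  have "(\<Sum>\<rho>\<in>UNIV. \<Sum>\<sigma>\<in>UNIV. ?F A \<mu> \<nu> * h $ \<mu> $ \<rho> * h $ \<nu> $ \<sigma> * ?F B \<rho> \<sigma> * \<delta> A B)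
      = k \<mu> \<nu> * (\<delta> A B * ?F A \<mu> \<nu> * ?F B \<mu> \<nu>)" (is "?l = _") for A B \<mu> \<nu>
  proof -
    have "?l = (\<Sum>\<rho>\<in>UNIV. h $ \<mu> $ \<rho> * (\<Sum>\<sigma>\<in>UNIV. h $ \<nu> $ \<sigma> * (?F A \<mu> \<nu> * ?F B \<rho> \<sigma> * \<delta> A B)))"
      by (simp add: sum_distrib_left ac_simps)
    then show ?thesis by (simp add: h_sum k_def)
  qed
  then have "yang_mills c \<delta> h j = - (1/4) *
      (\<Sum>A\<in>UNIV. \<Sum>B\<in>UNIV. \<Sum>\<mu>\<in>UNIV. \<Sum>\<nu>\<in>UNIV. k \<mu> \<nu> * (\<delta> A B * ?F A \<mu> \<nu> * ?F B \<mu> \<nu>))"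
    by (simp only: yang_mills_def)
  also have "(\<Sum>A\<in>UNIV. \<Sum>B\<in>UNIV. \<Sum>\<mu>\<in>UNIV. \<Sum>\<nu>\<in>UNIV. k \<mu> \<nu> * (\<delta> A B * ?F A \<mu> \<nu> * ?F B \<mu> \<nu>))
      = (\<Sum>A\<in>UNIV. \<Sum>\<mu>\<in>UNIV. \<Sum>B\<in>UNIV. \<Sum>\<nu>\<in>UNIV. k \<mu> \<nu> * (\<delta> A B * ?F A \<mu> \<nu> * ?F B \<mu> \<nu>))"
    by (rule sum.cong[OF refl], rule sum.swap)
  also have "\<dots> = (\<Sum>A\<in>UNIV. \<Sum>\<mu>\<in>UNIV. \<Sum>\<nu>\<in>UNIV. \<Sum>B\<in>UNIV. k \<mu> \<nu> * (\<delta> A B * ?F A \<mu> \<nu> * ?F B \<mu> \<nu>))"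
    by (rule sum.cong[OF refl], rule sum.cong[OF refl], rule sum.swap)
  also have "\<dots> = (\<Sum>\<mu>\<in>UNIV. \<Sum>A\<in>UNIV. \<Sum>\<nu>\<in>UNIV. \<Sum>B\<in>UNIV. k \<mu> \<nu> * (\<delta> A B * ?F A \<mu> \<nu> * ?F B \<mu> \<nu>))"
    by (rule sum.swap)
  also have "\<dots> = (\<Sum>\<mu>\<in>UNIV. \<Sum>\<nu>\<in>UNIV. \<Sum>A\<in>UNIV. \<Sum>B\<in>UNIV. k \<mu> \<nu> * (\<delta> A B * ?F A \<mu> \<nu> * ?F B \<mu> \<nu>))"
    by (rule sum.cong[OF refl], rule sum.swap)
  finally show "yang_mills c \<delta> h j
      = - (1/4) * (\<Sum>\<mu>\<in>UNIV. \<Sum>\<nu>\<in>UNIV. k \<mu> \<nu> * ip (curv \<mu> \<nu> j) (curv \<mu> \<nu> j))"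
    by (simp only: field_strength_curv ip_def metric_form_def sum_distrib_left)
qed

text \<open>The contraction of $X \in \mathfrak g$ with $E^\nu$; multiplication by \<^term>\<open>k \<mu> \<nu>\<close> raises the
  indices of the field strength.\<close>

definition ym_expr :: "'m \<Rightarrow> real^'g \<Rightarrow> ('m, 'g) jet \<Rightarrow> real" where
  "ym_expr \<nu> X j = (\<Sum>\<mu>\<in>UNIV. k \<mu> \<nu> *
     (ip X (dcurv \<mu> \<nu> j) + ip (curv \<mu> \<nu> j) (lie X (jet_coord {#} \<mu> j))))"

text \<open>The factor 1/4 has become 1/2 because both factors of the quadratic form contribute
  equally.\<close>

definition ym_jet :: "('m, 'g) jet \<Rightarrow> ('m, 'g) jet \<Rightarrow> real" where
  "ym_jet j v = - (1/2) * (\<Sum>\<mu>\<in>UNIV. \<Sum>\<nu>\<in>UNIV. k \<mu> \<nu> * ip (curv \<mu> \<nu> j) (curv_jet \<mu> \<nu> j v))"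

lemma yang_mills_has_jet_derivative: "has_jet_derivative (yang_mills c \<delta> h) (ym_jet j) j"
proof -
  have "has_jet_derivative (yang_mills c \<delta> h) (\<lambda>v. - (1/4) * (\<Sum>\<mu>\<in>UNIV. \<Sum>\<nu>\<in>UNIV. k \<mu> \<nu> *
      (ip (curv \<mu> \<nu> j) (curv_jet \<mu> \<nu> j v) + ip (curv_jet \<mu> \<nu> j v) (curv \<mu> \<nu> j)))) j"
    unfolding yang_mills_eq
    by (intro has_jet_derivative_cmult has_jet_derivative_sum has_jet_derivative_ip
        curv_has_jet_derivative)
  also have "(\<lambda>v. - (1/4) * (\<Sum>\<mu>\<in>UNIV. \<Sum>\<nu>\<in>UNIV. k \<mu> \<nu> *
      (ip (curv \<mu> \<nu> j) (curv_jet \<mu> \<nu> j v) + ip (curv_jet \<mu> \<nu> j v) (curv \<mu> \<nu> j)))) = ym_jet j"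
    unfolding ym_jet_def ip_sym[of "curv_jet _ _ _ _"]
    by (simp add: fun_eq_iff sum_distrib_left)
  finally show ?thesis .
qed

section \<open>Partial derivatives of the Lagrangian and the field equations\<close>

lemma curv_jet_unit_empty:
  "curv_jet \<mu> \<rho> j (unit_jet {#} B \<nu>) =
     (if \<rho> = \<nu> then lie (jet_coord {#} \<mu> j) (axis B 1) else 0)
     + (if \<mu> = \<nu> then lie (axis B 1) (jet_coord {#} \<rho> j) else 0)"
  by (simp add: curv_jet_def lie.zero_left lie.zero_right)

lemma curv_jet_unit_single:
  "curv_jet \<mu> \<rho> j (unit_jet {#\<alpha>#} B \<nu>) =
     (if \<mu> = \<alpha> then if \<rho> = \<nu> then axis B 1 else 0 else 0)
     - (if \<mu> = \<nu> then if \<rho> = \<alpha> then axis B 1 else 0 else 0)"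
  by (auto simp: curv_jet_def lie.zero_left lie.zero_right)

lemma curv_jet_unit_other:
  "I \<noteq> {#} \<Longrightarrow> I \<notin> range (\<lambda>\<alpha>. {#\<alpha>#}) \<Longrightarrow> curv_jet \<mu> \<rho> j (unit_jet I B \<nu>) = 0"
  by (auto simp: curv_jet_def lie.zero_left lie.zero_right)

lemma ip_if_right: "ip X (if P then Y else 0) = (if P then ip X Y else 0)"
  by (simp add: ip.zero_right)

lemma ip_if_left: "ip (if P then X else 0) Y = (if P then ip X Y else 0)"
  by (simp add: ip.zero_left)

lemma mult_if_0: "a * (if P then x else 0) = (if P then a * x else (0::real))"
  by simp

text \<open>The potential enters the bracket in F both as first and as second factor. Each
  contribution is minus the stated sum, once by antisymmetry of the bracket and once by antisymmetry
  of F, which cancels the factor -1/2.\<close>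

lemma du_yang_mills_empty:
  "du {#} B \<nu> (yang_mills c \<delta> h) j =
     (\<Sum>\<mu>\<in>UNIV. k \<mu> \<nu> * ip (curv \<mu> \<nu> j) (lie (axis B 1) (jet_coord {#} \<mu> j)))"
proof -
  let ?w = "\<lambda>\<mu>. jet_coord {#} \<mu> j" and ?e = "axis B 1"
  have "du {#} B \<nu> (yang_mills c \<delta> h) j = - (1/2) *
     ((\<Sum>\<mu>\<in>UNIV. k \<mu> \<nu> * ip (curv \<mu> \<nu> j) (lie (?w \<mu>) ?e))
      + (\<Sum>\<mu>\<in>UNIV. k \<nu> \<mu> * ip (curv \<nu> \<mu> j) (lie ?e (?w \<mu>))))"
    unfolding du_eq[OF yang_mills_has_jet_derivative] ym_jet_def curv_jet_unit_empty
    by (simp add: ip.add_right distrib_left ip_if_right mult_if_0 sum.distrib sum_if_const del: mult_zero_right if_cancel)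
  also have "(\<Sum>\<mu>\<in>UNIV. k \<mu> \<nu> * ip (curv \<mu> \<nu> j) (lie (?w \<mu>) ?e))
      = - (\<Sum>\<mu>\<in>UNIV. k \<mu> \<nu> * ip (curv \<mu> \<nu> j) (lie ?e (?w \<mu>)))"
    by (subst lie_antisym) (simp add: ip.minus_right sum_negf)
  also have "(\<Sum>\<mu>\<in>UNIV. k \<nu> \<mu> * ip (curv \<nu> \<mu> j) (lie ?e (?w \<mu>)))
      = - (\<Sum>\<mu>\<in>UNIV. k \<mu> \<nu> * ip (curv \<mu> \<nu> j) (lie ?e (?w \<mu>)))"
    by (subst curv_antisym, subst k_sym) (simp add: ip.minus_left sum_negf)
  finally show ?thesis by simp
qed

text \<open>The coordinate occurs in F_{\<alpha>\<nu>} and F_{\<nu>\<alpha>} with opposite signs, so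
  the two halves add up. The equation is between functions because a total derivative is applied to
  it next.\<close>

lemma du_yang_mills_single:
  "du {#\<alpha>#} B \<nu> (yang_mills c \<delta> h) = (\<lambda>j. - k \<alpha> \<nu> * ip (axis B 1) (curv \<alpha> \<nu> j))"
proof
  fix j :: "('m, 'g) jet"
  let ?e = "axis B 1"
  have "du {#\<alpha>#} B \<nu> (yang_mills c \<delta> h) j = - (1/2) *
     (k \<alpha> \<nu> * ip (curv \<alpha> \<nu> j) ?e - k \<nu> \<alpha> * ip (curv \<nu> \<alpha> j) ?e)"
    unfolding du_eq[OF yang_mills_has_jet_derivative] ym_jet_def curv_jet_unit_single
    by (simp add: ip.diff_right right_diff_distrib ip_if_right mult_if_0 sum_subtractf sum_if_const)
  then show "du {#\<alpha>#} B \<nu> (yang_mills c \<delta> h) j = - k \<alpha> \<nu> * ip ?e (curv \<alpha> \<nu> j)"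
    using curv_antisym[of \<nu> \<alpha> j] by (simp add: k_sym[of \<nu>] ip.minus_left ip_sym[of ?e])
qed

lemma du_yang_mills_other:
  assumes "I \<noteq> {#}" "I \<notin> range (\<lambda>\<alpha>. {#\<alpha>#})"
  shows "du I B \<nu> (yang_mills c \<delta> h) j = 0"
  unfolding du_eq[OF yang_mills_has_jet_derivative] ym_jet_def curv_jet_unit_other[OF assms]
  by (simp add: ip.zero_right)

lemma euler_lagrange_yang_mills:
  "euler_lagrange (yang_mills c \<delta> h) \<nu> B j = ym_expr \<nu> (axis B 1) j"
proof -
  let ?L = "yang_mills c \<delta> h"
  let ?S = "insert {#} (range (\<lambda>\<alpha>. {#\<alpha>#}))"
  let ?t = "\<lambda>I. (-1) ^ size I * total_deriv_multi I (du I B \<nu> ?L) j"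
  have 0: "?t I = 0" if "I \<notin> ?S" for I
    using that total_deriv_multi_eq_0[of UNIV "du I B \<nu> ?L" j I] du_yang_mills_other[of I] by simp
  have "euler_lagrange ?L \<nu> B j = sum ?t ?S"
    unfolding euler_lagrange_def
  proof (rule Sum_any.expand_superset)
    show "{I. ?t I \<noteq> 0} \<subseteq> ?S" using 0 by blast
  qed simp
  also have "\<dots> = ?t {#} + (\<Sum>\<alpha>\<in>UNIV. ?t {#\<alpha>#})"
    by (subst sum.insert) (auto simp: sum.reindex inj_on_def)
  also have "(\<Sum>\<alpha>\<in>UNIV. ?t {#\<alpha>#}) = (\<Sum>\<alpha>\<in>UNIV. k \<alpha> \<nu> * ip (axis B 1) (dcurv \<alpha> \<nu> j))"
  proof (rule sum.cong[OF refl])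
    fix \<alpha>
    have "has_jet_derivative (\<lambda>j. - k \<alpha> \<nu> * ip (axis B 1) (curv \<alpha> \<nu> j))
       (\<lambda>v. - k \<alpha> \<nu> * ip (axis B 1) (curv_jet \<alpha> \<nu> j v)) j"
      by (intro has_jet_derivative_cmult curv_has_jet_derivative
          has_jet_derivative_linear[OF ip.bounded_linear_right])
    from total_deriv_eq[OF this, of \<alpha>]
    show "?t {#\<alpha>#} = k \<alpha> \<nu> * ip (axis B 1) (dcurv \<alpha> \<nu> j)"
      by (simp add: du_yang_mills_single curv_jet_total_vector)
  qed
  finally show ?thesis
    by (simp add: ym_expr_def du_yang_mills_empty distrib_left sum.distrib)
qed

lemma linear_ym_expr: "linear (\<lambda>X. ym_expr \<nu> X j)"
  unfolding ym_expr_def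
  by (rule linearI)
    (simp_all add: ip.add_left ip.add_right lie.add_left ip.scaleR_left ip.scaleR_right lie.scaleR_left
      distrib_left sum.distrib sum_distrib_left ac_simps)

lemma vec_expansion: "(X::real^'n::finite) = (\<Sum>B\<in>UNIV. X $ B *\<^sub>R axis B 1)"
  by (simp add: vec_eq_iff axis_def if_distrib[of "(*) _"] cong: if_cong)

text \<open>By this expansion the field equations in components annihilate
  \<open>ym_expr \<nu> X\<close> for every \<open>X\<close>, in particular for derivatives of
  \<Xi>.\<close>

lemma sum_ym_expr_axis: "(\<Sum>B\<in>UNIV. X $ B * ym_expr \<nu> (axis B 1) j) = ym_expr \<nu> X j"
  by (subst (2) vec_expansion)
    (simp add: linear_sum[OF linear_ym_expr] linear_cmul[OF linear_ym_expr])

end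

section \<open>The Jacobi equation\<close>

lemma indicator_mult: "(if P then 1 else 0) * x = (if P then x else (0::real))"
  by simp

lemma indicator_cong:
  "(P \<Longrightarrow> x = y) \<Longrightarrow> (if P then 1 else 0) * x = (if P then 1 else 0) * (y::real)"
  by simp

locale yang_mills_vertical_field = yang_mills_jets c \<delta> h + smooth_vertical_field U \<Xi>
  for c :: "'g::finite \<Rightarrow> 'g \<Rightarrow> 'g \<Rightarrow> real"
    and \<delta> :: "'g \<Rightarrow> 'g \<Rightarrow> real"
    and h :: "'m::{finite,linorder} metric"
    and U :: "'m base set"
    and \<Xi> :: "'m base \<times> ('m, 'g) pot \<Rightarrow> ('m, 'g) pot"
begin

abbreviation contraction :: "('m, 'g) jet \<Rightarrow> real" where
  "contraction \<equiv> vf_contraction \<Xi> (yang_mills c \<delta> h)"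

text \<open>The part of the differential of the contraction in which the vector field is not
  differentiated.\<close>

definition fixed_field_jet :: "('m, 'g) jet \<Rightarrow> ('m, 'g) jet \<Rightarrow> real" where
  "fixed_field_jet j v = (\<Sum>\<nu>\<in>UNIV. \<Sum>\<mu>\<in>UNIV. k \<mu> \<nu> *
     (ip (field \<nu> j) (dcurv_jet \<mu> \<nu> j v)
      + ip (curv \<mu> \<nu> j) (lie (field \<nu> j) (jet_coord {#} \<mu> v))
      + ip (curv_jet \<mu> \<nu> j v) (lie (field \<nu> j) (jet_coord {#} \<mu> j))))"

lemma contraction_eq: "contraction = (\<lambda>j. \<Sum>\<nu>\<in>UNIV. ym_expr \<nu> (field \<nu> j) j)"
proof
  fix j
  have "contraction j = (\<Sum>\<nu>\<in>UNIV. \<Sum>B\<in>UNIV. field \<nu> j $ B * ym_expr \<nu> (axis B 1) j)"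
    by (subst sum.swap) (simp add: vf_contraction_def euler_lagrange_yang_mills vf_comp_field)
  then show "contraction j = (\<Sum>\<nu>\<in>UNIV. ym_expr \<nu> (field \<nu> j) j)"
    by (simp add: sum_ym_expr_axis)
qed

text \<open>The product rule, sorted by whether \<Xi> is differentiated. The differentiated part is
  E contracted with a derivative of \<Xi>; it disappears if E vanishes at \<open>j\<close> or if
  \<open>v\<close> changes neither x nor \<omega>.\<close>

lemma contraction_has_jet_derivative:
  assumes "fst j \<in> U"
  shows "has_jet_derivative contraction
    (\<lambda>v. fixed_field_jet j v + (\<Sum>\<nu>\<in>UNIV. ym_expr \<nu> (field_jet \<nu> j v) j)) j"
proof -
  have "has_jet_derivative contraction (\<lambda>v. \<Sum>\<nu>\<in>UNIV. \<Sum>\<mu>\<in>UNIV. k \<mu> \<nu> *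
      ((ip (field \<nu> j) (dcurv_jet \<mu> \<nu> j v) + ip (field_jet \<nu> j v) (dcurv \<mu> \<nu> j))
     + (ip (curv \<mu> \<nu> j) (lie (field \<nu> j) (jet_coord {#} \<mu> v) + lie (field_jet \<nu> j v) (jet_coord {#} \<mu> j))
     + ip (curv_jet \<mu> \<nu> j v) (lie (field \<nu> j) (jet_coord {#} \<mu> j))))) j"
    unfolding contraction_eq ym_expr_def
    by (intro has_jet_derivative_sum has_jet_derivative_cmult has_jet_derivative_add
        has_jet_derivative_ip has_jet_derivative_lie curv_has_jet_derivative
        dcurv_has_jet_derivative has_jet_derivative_coord field_has_jet_derivative assms)
  then show ?thesis
    by (rule back_subst[of "\<lambda>D. has_jet_derivative _ D _"])
      (simp add: fun_eq_iff fixed_field_jet_def ym_expr_def ip.add_right distrib_left sum.distrib)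
qed

lemma du_contraction:
  assumes "fst j \<in> U" "I \<noteq> {#}"
  shows "du I C \<kappa> contraction j = fixed_field_jet j (unit_jet I C \<kappa>)"
  by (simp add: du_eq[OF contraction_has_jet_derivative[OF assms(1)]] field_jet_unit[OF assms]
      linear_0[OF linear_ym_expr])

text \<open>The field equations enter the computation here, and only at the jet \<open>j\<close>
  itself; that is enough because this partial derivative is not differentiated further.\<close>

lemma du_contraction_empty:
  assumes "fst j \<in> U" "\<And>\<nu> B. ym_expr \<nu> (axis B 1) j = 0"
  shows "du {#} C \<kappa> contraction j = fixed_field_jet j (unit_jet {#} C \<kappa>)"
proof -
  have "ym_expr \<nu> X j = 0" for \<nu> X
    using sum_ym_expr_axis[of X \<nu> j] by (simp add: assms(2))
  then show ?thesis
    by (simp add: du_eq[OF contraction_has_jet_derivative[OF assms(1)]])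
qed

section \<open>Partial derivatives of the contraction by order, and their total derivatives\<close>

lemma fixed_field_jet_unit_empty:
  "fixed_field_jet j (unit_jet {#} C \<kappa>) = (\<Sum>\<mu>\<in>UNIV. k \<mu> \<kappa> *
     (ip (field \<mu> j) (lie (axis C 1) (jet_coord {#\<kappa>#} \<mu> j))
      + ip (lie (axis C 1) (jet_coord {#} \<mu> j)) (lie (field \<mu> j) (jet_coord {#} \<kappa> j))
      + ip (curv \<kappa> \<mu> j) (lie (field \<mu> j) (axis C 1))
      + ip (field \<kappa> j) (lie (jet_coord {#\<mu>#} \<mu> j) (axis C 1))
      + ip (lie (jet_coord {#} \<mu> j) (axis C 1)) (lie (field \<kappa> j) (jet_coord {#} \<mu> j))))"
proof -
  let ?u = "unit_jet {#} C \<kappa>" and ?e = "axis C 1"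
  have d: "dcurv_jet \<mu> \<nu> j ?u =
      (if \<mu> = \<kappa> then lie ?e (jet_coord {#\<mu>#} \<nu> j) else 0)
      + (if \<nu> = \<kappa> then lie (jet_coord {#\<mu>#} \<mu> j) ?e else 0)" for \<mu> \<nu>
    by (simp add: dcurv_jet_def lie.zero_left lie.zero_right)
  have l: "lie X (jet_coord {#} \<mu> ?u) = (if \<mu> = \<kappa> then lie X ?e else 0)" for X \<mu>
    by (simp add: lie.zero_right)
  show ?thesis
    unfolding fixed_field_jet_def d l curv_jet_unit_empty
    by (simp add: ip.add_right ip.add_left distrib_left ip_if_right ip_if_left mult_if_0 sum.distrib
        sum_if_const k_sym)
qed

text \<open>For \<alpha> = \<kappa> the coordinate enters d_\<kappa> F_{\<kappa>\<nu>} through a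
  bracket for every \<nu>, hence the full sum. The condition is written as a numerical factor so
  that it passes through differentiation as a constant.\<close>

lemma fixed_field_jet_unit_single:
  "fixed_field_jet j (unit_jet {#\<alpha>#} C \<kappa>) =
     (if \<alpha> = \<kappa> then 1 else 0) *
       (\<Sum>\<nu>\<in>UNIV. k \<nu> \<kappa> * ip (field \<nu> j) (lie (axis C 1) (jet_coord {#} \<nu> j)))
     + k \<alpha> \<kappa> * (ip (field \<kappa> j) (lie (jet_coord {#} \<alpha> j) (axis C 1))
       + ip (axis C 1) (lie (field \<kappa> j) (jet_coord {#} \<alpha> j))
       - ip (axis C 1) (lie (field \<alpha> j) (jet_coord {#} \<kappa> j)))"
proof -
  let ?u = "unit_jet {#\<alpha>#} C \<kappa>" and ?e = "axis C 1"
  have d: "dcurv_jet \<mu> \<nu> j ?u =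
      (if \<mu> = \<alpha> then if \<nu> = \<kappa> then lie (jet_coord {#} \<mu> j) ?e else 0 else 0)
      + (if \<alpha> = \<kappa> then if \<mu> = \<alpha> then lie ?e (jet_coord {#} \<nu> j) else 0 else 0)" for \<mu> \<nu>
    by (auto simp: dcurv_jet_def lie.zero_left lie.zero_right)
  have l: "lie X (jet_coord {#} \<mu> ?u) = 0" for X \<mu>
    by (simp add: lie.zero_right)
  show ?thesis
    unfolding fixed_field_jet_def d l curv_jet_unit_single
    by (simp add: ip.add_right ip.add_left ip.diff_left ip.zero_right distrib_left right_diff_distrib
        ip_if_right ip_if_left mult_if_0 sum.distrib sum_subtractf sum_if_const k_sym)
qed

text \<open>All orders from two upwards are covered: from order three on both indicators are 0,
  which bounds the support of the Euler-Lagrange sum.\<close>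

lemma fixed_field_jet_unit_pair:
  assumes "I \<noteq> {#}" "I \<notin> range (\<lambda>\<alpha>. {#\<alpha>#})"
  shows "fixed_field_jet j (unit_jet I C \<kappa>) =
     (\<Sum>\<mu>\<in>UNIV. k \<mu> \<kappa> * ((if {#\<mu>, \<mu>#} = I then 1 else 0) * ip (field \<kappa> j) (axis C 1)
       - (if {#\<kappa>, \<mu>#} = I then 1 else 0) * ip (field \<mu> j) (axis C 1)))"
proof -
  let ?u = "unit_jet I C \<kappa>" and ?e = "axis C 1"
  have d: "dcurv_jet \<mu> \<nu> j ?u =
      (if \<nu> = \<kappa> then if {#\<mu>, \<mu>#} = I then ?e else 0 else 0)
      - (if \<mu> = \<kappa> then if {#\<kappa>, \<nu>#} = I then ?e else 0 else 0)" for \<mu> \<nu>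
    using assms by (auto simp: dcurv_jet_def lie.zero_left lie.zero_right)
  have l: "lie X (jet_coord {#} \<mu> ?u) = 0" for X \<mu>
    using assms by (auto simp: lie.zero_right)
  show ?thesis
    unfolding fixed_field_jet_def d l curv_jet_unit_other[OF assms]
    by (simp add: ip.diff_right ip.zero_left ip.zero_right right_diff_distrib ip_if_right mult_if_0
        sum_subtractf sum_if_const k_sym indicator_mult)
qed

lemma total_deriv_du_single:
  assumes "fst j \<in> U"
  shows "total_deriv \<alpha> (du {#\<alpha>#} C \<kappa> contraction) j =
     (if \<alpha> = \<kappa> then 1 else 0) *
       (\<Sum>\<nu>\<in>UNIV. k \<nu> \<kappa> * (ip (field \<nu> j) (lie (axis C 1) (jet_coord {#\<alpha>#} \<nu> j))
          + ip (field1 \<alpha> \<nu> j) (lie (axis C 1) (jet_coord {#} \<nu> j))))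
     + k \<alpha> \<kappa> * ((ip (field \<kappa> j) (lie (jet_coord {#\<alpha>#} \<alpha> j) (axis C 1))
          + ip (field1 \<alpha> \<kappa> j) (lie (jet_coord {#} \<alpha> j) (axis C 1)))
       + ip (axis C 1) (lie (field \<kappa> j) (jet_coord {#\<alpha>#} \<alpha> j) + lie (field1 \<alpha> \<kappa> j) (jet_coord {#} \<alpha> j))
       - ip (axis C 1) (lie (field \<alpha> j) (jet_coord {#\<alpha>#} \<kappa> j) + lie (field1 \<alpha> \<alpha> j) (jet_coord {#} \<kappa> j)))"
proof -
  let ?e = "axis C 1"
  have "has_jet_derivative (\<lambda>j. (if \<alpha> = \<kappa> then 1 else 0) *
       (\<Sum>\<nu>\<in>UNIV. k \<nu> \<kappa> * ip (field \<nu> j) (lie ?e (jet_coord {#} \<nu> j)))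
     + k \<alpha> \<kappa> * (ip (field \<kappa> j) (lie (jet_coord {#} \<alpha> j) ?e)
       + ip ?e (lie (field \<kappa> j) (jet_coord {#} \<alpha> j))
       - ip ?e (lie (field \<alpha> j) (jet_coord {#} \<kappa> j))))
    (\<lambda>v. (if \<alpha> = \<kappa> then 1 else 0) *
       (\<Sum>\<nu>\<in>UNIV. k \<nu> \<kappa> * (ip (field \<nu> j) (lie ?e (jet_coord {#} \<nu> v))
          + ip (field_jet \<nu> j v) (lie ?e (jet_coord {#} \<nu> j))))
     + k \<alpha> \<kappa> * ((ip (field \<kappa> j) (lie (jet_coord {#} \<alpha> v) ?e)
          + ip (field_jet \<kappa> j v) (lie (jet_coord {#} \<alpha> j) ?e))
       + ip ?e (lie (field \<kappa> j) (jet_coord {#} \<alpha> v) + lie (field_jet \<kappa> j v) (jet_coord {#} \<alpha> j))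
       - ip ?e (lie (field \<alpha> j) (jet_coord {#} \<kappa> v) + lie (field_jet \<alpha> j v) (jet_coord {#} \<kappa> j)))) j"
    by (intro has_jet_derivative_add has_jet_derivative_diff has_jet_derivative_cmult
        has_jet_derivative_sum has_jet_derivative_ip has_jet_derivative_coord
        field_has_jet_derivative assms
        has_jet_derivative_linear[OF ip.bounded_linear_right] has_jet_derivative_lie
        has_jet_derivative_linear[OF lie.bounded_linear_right]
        has_jet_derivative_linear[OF lie.bounded_linear_left])
  from total_deriv_cong[OF open_U assms _ this, of "du {#\<alpha>#} C \<kappa> contraction" \<alpha>]
  show ?thesis
    by (simp only: du_contraction fixed_field_jet_unit_single field_jet_total_vector
        jet_coord_total_vector add_mset_eq_singleton_iff) (simp add: du_contraction fixed_field_jet_unit_single)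
qed

lemma total_deriv_multi_du_pair:
  assumes "fst j \<in> U"
  shows "total_deriv_multi {#\<alpha>, \<beta>#} (du {#\<alpha>, \<beta>#} C \<kappa> contraction) j =
     (\<Sum>\<mu>\<in>UNIV. k \<mu> \<kappa> * ((if {#\<mu>, \<mu>#} = {#\<alpha>, \<beta>#} then 1 else 0) * ip (field2 \<mu> \<mu> \<kappa> j) (axis C 1)
       - (if {#\<kappa>, \<mu>#} = {#\<alpha>, \<beta>#} then 1 else 0) * ip (field2 \<mu> \<kappa> \<mu> j) (axis C 1)))"
proof -
  let ?I = "{#\<alpha>, \<beta>#}" and ?e = "axis C 1"
  let ?s = "\<lambda>X. \<Sum>\<mu>\<in>UNIV. k \<mu> \<kappa> * ((if {#\<mu>, \<mu>#} = ?I then 1 else 0) * ip (X \<kappa>) ?e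
       - (if {#\<kappa>, \<mu>#} = ?I then 1 else 0) * ip (X \<mu>) ?e)"
  have d: "has_jet_derivative (\<lambda>j. ?s (\<lambda>\<nu>. X \<nu> j)) (\<lambda>v. ?s (\<lambda>\<nu>. X' \<nu> v)) j'"
    if "\<And>\<nu>. has_jet_derivative (X \<nu>) (X' \<nu>) j'" for X X' and j' :: "('m, 'g) jet"
    by (intro has_jet_derivative_sum has_jet_derivative_cmult has_jet_derivative_diff
        has_jet_derivative_linear[OF ip.bounded_linear_left] that)
  obtain a b where ab: "{#a, b#} = ?I" and
    td: "total_deriv_multi ?I (du ?I C \<kappa> contraction) = total_deriv a (total_deriv b (du ?I C \<kappa> contraction))"
    using total_deriv_multi_pair[of \<alpha> \<beta> "du ?I C \<kappa> contraction"] by blast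
  have 1: "total_deriv b (du ?I C \<kappa> contraction) j' = ?s (\<lambda>\<nu>. field1 b \<nu> j')" if "fst j' \<in> U" for j'
  proof -
    have "du ?I C \<kappa> contraction j'' = ?s (\<lambda>\<nu>. field \<nu> j'')" if "fst j'' \<in> U" for j''
    proof -
      have "?I \<noteq> {#}" "?I \<notin> range (\<lambda>\<alpha>. {#\<alpha>#})" by auto
      then show ?thesis
        by (simp only: du_contraction[OF that] fixed_field_jet_unit_pair not_False_eq_True)
    qed
    from total_deriv_cong[OF open_U that this d[OF field_has_jet_derivative[OF that]]]
    show ?thesis
      by (simp only: field_jet_total_vector)
  qed
  have "total_deriv a (total_deriv b (du ?I C \<kappa> contraction)) j
      = ?s (\<lambda>\<nu>. field1_jet b \<nu> j (total_vector a j))"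
    by (rule total_deriv_cong[OF open_U assms 1 d[OF field1_has_jet_derivative[OF assms]]])
  also have "\<dots> = ?s (\<lambda>\<nu>. field2 a b \<nu> j)" by (simp only: field2_def)
  also have "\<dots> = (\<Sum>\<mu>\<in>UNIV. k \<mu> \<kappa> * ((if {#\<mu>, \<mu>#} = ?I then 1 else 0) * ip (field2 \<mu> \<mu> \<kappa> j) ?e
       - (if {#\<kappa>, \<mu>#} = ?I then 1 else 0) * ip (field2 \<mu> \<kappa> \<mu> j) ?e))"
  proof (rule sum.cong[OF refl])
    fix \<mu>
    \<comment> \<open>An indicator equal to 1 fixes the multiset of \<open>a\<close> and
      \<open>b\<close>. For a mixed pair their order may still be reversed, which
      \<open>field2_commute\<close> absorbs.\<close>
    have "field2 a b \<kappa> j = field2 \<mu> \<mu> \<kappa> j" if "{#\<mu>, \<mu>#} = ?I"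
      using that unfolding ab[symmetric] by (auto simp: add_eq_conv_ex)
    moreover have "field2 a b \<mu> j = field2 \<mu> \<kappa> \<mu> j" if "{#\<kappa>, \<mu>#} = ?I"
    proof -
      have "a = \<kappa> \<and> b = \<mu> \<or> a = \<mu> \<and> b = \<kappa>"
        using that unfolding ab[symmetric] by (auto simp: add_eq_conv_ex)
      then show ?thesis using field2_commute[OF assms] by blast
    qed
    ultimately show "k \<mu> \<kappa> * ((if {#\<mu>, \<mu>#} = ?I then 1 else 0) * ip (field2 a b \<kappa> j) ?e
       - (if {#\<kappa>, \<mu>#} = ?I then 1 else 0) * ip (field2 a b \<mu> j) ?e)
      = k \<mu> \<kappa> * ((if {#\<mu>, \<mu>#} = ?I then 1 else 0) * ip (field2 \<mu> \<mu> \<kappa> j) ?e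
       - (if {#\<kappa>, \<mu>#} = ?I then 1 else 0) * ip (field2 \<mu> \<kappa> \<mu> j) ?e)"
      by (intro arg_cong2[of _ _ _ _ "(*)"] arg_cong2[of _ _ _ _ "(-)"] refl indicator_cong) simp_all
  qed
  finally show ?thesis by (simp only: td)
qed

lemma total_deriv_multi_du_other:
  assumes "fst j \<in> U" "I \<noteq> {#}" "I \<notin> range (\<lambda>\<alpha>. {#\<alpha>#})" "I \<notin> range (\<lambda>(\<alpha>, \<beta>). {#\<alpha>, \<beta>#})"
  shows "total_deriv_multi I (du I C \<kappa> contraction) j = 0"
proof (rule total_deriv_multi_eq_0[OF open_U _ assms(1)])
  have "{#\<mu>, \<nu>#} \<in> range (\<lambda>(\<alpha>, \<beta>). {#\<alpha>, \<beta>#})" for \<mu> \<nu> :: 'm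
    by (rule range_eqI[of _ _ "(\<mu>, \<nu>)"]) simp
  then have "{#\<mu>, \<nu>#} \<noteq> I" for \<mu> \<nu>
    using assms(4) by blast
  then show "du I C \<kappa> contraction j = 0" if "fst j \<in> U" for j
    by (simp add: du_contraction[OF that assms(2)] fixed_field_jet_unit_pair[OF assms(2,3)])
qed

section \<open>The linearised Yang-Mills operator and its self-adjointness\<close>

definition cov_curl :: "'m \<Rightarrow> 'm \<Rightarrow> ('m, 'g) jet \<Rightarrow> real^'g" where
  "cov_curl \<mu> \<nu> j = field1 \<mu> \<nu> j + lie (jet_coord {#} \<mu> j) (field \<nu> j)
     - (field1 \<nu> \<mu> j + lie (jet_coord {#} \<nu> j) (field \<mu> j))"

text \<open>The plain total derivative d_\<mu> of \<open>cov_curl \<mu> \<nu>\<close>, which is the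
  curvature linearised along \<Xi>. The connection term of the outer covariant derivative is kept
  apart in \<open>jacobi_expr\<close>.\<close>

definition dcov_curl :: "'m \<Rightarrow> 'm \<Rightarrow> ('m, 'g) jet \<Rightarrow> real^'g" where
  "dcov_curl \<mu> \<nu> j =
     field2 \<mu> \<mu> \<nu> j + (lie (jet_coord {#} \<mu> j) (field1 \<mu> \<nu> j) + lie (jet_coord {#\<mu>#} \<mu> j) (field \<nu> j))
     - (field2 \<mu> \<nu> \<mu> j + (lie (jet_coord {#} \<nu> j) (field1 \<mu> \<mu> j) + lie (jet_coord {#\<mu>#} \<nu> j) (field \<mu> j)))"

text \<open>The claimed operator contracted with \<open>X\<close>, after the diagonal metric has
  equated the paired indices. The connection term for a lower Lie algebra index becomes a pairing
  with the bracket of \<open>X\<close> and the potential.\<close>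

definition jacobi_expr :: "'m \<Rightarrow> real^'g \<Rightarrow> ('m, 'g) jet \<Rightarrow> real" where
  "jacobi_expr \<nu> X j = (\<Sum>\<mu>\<in>UNIV. k \<mu> \<nu> *
     (ip X (dcov_curl \<mu> \<nu> j) + ip (cov_curl \<mu> \<nu> j) (lie X (jet_coord {#} \<mu> j))
      + ip (curv \<mu> \<nu> j) (lie X (field \<mu> j))))"

text \<open>The part with the indicator survives for one \<alpha> only but is itself a sum over all
  indices, so everything fits under a single sum and can be compared summand by summand.\<close>

lemma sum_total_deriv_du_single:
  assumes "fst j \<in> U"
  shows "(\<Sum>\<alpha>\<in>UNIV. total_deriv \<alpha> (du {#\<alpha>#} C \<kappa> contraction) j) = (\<Sum>\<mu>\<in>UNIV. k \<mu> \<kappa> *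
     (ip (field \<mu> j) (lie (axis C 1) (jet_coord {#\<kappa>#} \<mu> j))
      + ip (field1 \<kappa> \<mu> j) (lie (axis C 1) (jet_coord {#} \<mu> j))
      + ip (field \<kappa> j) (lie (jet_coord {#\<mu>#} \<mu> j) (axis C 1))
      + ip (field1 \<mu> \<kappa> j) (lie (jet_coord {#} \<mu> j) (axis C 1))
      + ip (axis C 1) (lie (field \<kappa> j) (jet_coord {#\<mu>#} \<mu> j) + lie (field1 \<mu> \<kappa> j) (jet_coord {#} \<mu> j))
      - ip (axis C 1) (lie (field \<mu> j) (jet_coord {#\<mu>#} \<kappa> j) + lie (field1 \<mu> \<mu> j) (jet_coord {#} \<kappa> j))))"
  unfolding total_deriv_du_single[OF assms] indicator_mult sum.distrib sum.delta[OF finite_class.finite_UNIV]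
  by (simp add: sum.distrib distrib_left flip: sum_subtractf)
     (simp add: sum.distrib sum_subtractf algebra_simps)

text \<open>The sum runs over unordered pairs. For each \<mu> exactly one multiset meets each
  indicator, so no combinatorial factor appears.\<close>

lemma sum_total_deriv_multi_du_pair:
  assumes "fst j \<in> U"
  shows "(\<Sum>I\<in>range (\<lambda>(\<alpha>, \<beta>). {#\<alpha>, \<beta>#}). total_deriv_multi I (du I C \<kappa> contraction) j) =
     (\<Sum>\<mu>\<in>UNIV. k \<mu> \<kappa> * (ip (field2 \<mu> \<mu> \<kappa> j) (axis C 1) - ip (field2 \<mu> \<kappa> \<mu> j) (axis C 1)))"
proof -
  let ?A = "range (\<lambda>(\<alpha>::'m, \<beta>). {#\<alpha>, \<beta>#})" and ?e = "axis C 1"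
  have A: "finite ?A" "{#\<mu>, \<nu>#} \<in> ?A" for \<mu> \<nu> :: 'm by (auto intro: rev_image_eqI[of "(\<mu>, \<nu>)"])
  have "(\<Sum>I\<in>?A. total_deriv_multi I (du I C \<kappa> contraction) j) =
     (\<Sum>I\<in>?A. \<Sum>\<mu>\<in>UNIV. k \<mu> \<kappa> * ((if {#\<mu>, \<mu>#} = I then ip (field2 \<mu> \<mu> \<kappa> j) ?e else 0)
       - (if {#\<kappa>, \<mu>#} = I then ip (field2 \<mu> \<kappa> \<mu> j) ?e else 0)))"
  proof (rule sum.cong[OF refl])
    fix I assume "I \<in> ?A"
    then obtain \<alpha> \<beta> where "I = {#\<alpha>, \<beta>#}" by auto
    then show "total_deriv_multi I (du I C \<kappa> contraction) j =
        (\<Sum>\<mu>\<in>UNIV. k \<mu> \<kappa> * ((if {#\<mu>, \<mu>#} = I then ip (field2 \<mu> \<mu> \<kappa> j) ?e else 0)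
       - (if {#\<kappa>, \<mu>#} = I then ip (field2 \<mu> \<kappa> \<mu> j) ?e else 0)))"
      by (simp only: total_deriv_multi_du_pair[OF assms] indicator_mult)
  qed
  also have "\<dots> = (\<Sum>\<mu>\<in>UNIV. k \<mu> \<kappa> * ((\<Sum>I\<in>?A. if {#\<mu>, \<mu>#} = I then ip (field2 \<mu> \<mu> \<kappa> j) ?e else 0)
       - (\<Sum>I\<in>?A. if {#\<kappa>, \<mu>#} = I then ip (field2 \<mu> \<kappa> \<mu> j) ?e else 0)))"
    by (subst sum.swap) (simp only: sum_distrib_left[symmetric] sum_subtractf)
  finally show ?thesis by (simp only: sum.delta'[OF A(1)] A(2) if_True)
qed

text \<open>Formal self-adjointness for a fixed \<mu>: the contributions of orders 0, 1 and 2 enter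
  with alternating signs. The terms pairing \<Xi> with a bracket of \<open>e\<close> and a first
  derivative of the potential cancel between orders 0 and 1; the rest regroups into the linearised
  operator.\<close>

lemma jacobi_term:
  "(ip (field \<mu> j) (lie e (jet_coord {#\<kappa>#} \<mu> j))
      + ip (lie e (jet_coord {#} \<mu> j)) (lie (field \<mu> j) (jet_coord {#} \<kappa> j))
      + ip (curv \<kappa> \<mu> j) (lie (field \<mu> j) e)
      + ip (field \<kappa> j) (lie (jet_coord {#\<mu>#} \<mu> j) e)
      + ip (lie (jet_coord {#} \<mu> j) e) (lie (field \<kappa> j) (jet_coord {#} \<mu> j)))
    - (ip (field \<mu> j) (lie e (jet_coord {#\<kappa>#} \<mu> j))
      + ip (field1 \<kappa> \<mu> j) (lie e (jet_coord {#} \<mu> j))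
      + ip (field \<kappa> j) (lie (jet_coord {#\<mu>#} \<mu> j) e)
      + ip (field1 \<mu> \<kappa> j) (lie (jet_coord {#} \<mu> j) e)
      + ip e (lie (field \<kappa> j) (jet_coord {#\<mu>#} \<mu> j) + lie (field1 \<mu> \<kappa> j) (jet_coord {#} \<mu> j))
      - ip e (lie (field \<mu> j) (jet_coord {#\<mu>#} \<kappa> j) + lie (field1 \<mu> \<mu> j) (jet_coord {#} \<kappa> j)))
    + (ip (field2 \<mu> \<mu> \<kappa> j) e - ip (field2 \<mu> \<kappa> \<mu> j) e)
   = ip e (dcov_curl \<mu> \<kappa> j) + ip (cov_curl \<mu> \<kappa> j) (lie e (jet_coord {#} \<mu> j))
      + ip (curv \<mu> \<kappa> j) (lie e (field \<mu> j))"
proof -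
  let ?w = "\<lambda>\<mu>. jet_coord {#} \<mu> j" and ?X = "\<lambda>\<mu>. field \<mu> j" and ?dw = "\<lambda>\<alpha> \<mu>. jet_coord {#\<alpha>#} \<mu> j"
    and ?dX = "\<lambda>\<alpha> \<mu>. field1 \<alpha> \<mu> j"
  \<comment> \<open>All surviving brackets get one orientation, \<open>e\<close> first and otherwise
    the potential before \<Xi>, so that both sides consist of the same terms.\<close>
  have anti: "lie (?X \<nu>) (?w \<rho>) = - lie (?w \<rho>) (?X \<nu>)" "lie (?X \<nu>) e = - lie e (?X \<nu>)"
    "lie (?w \<nu>) e = - lie e (?w \<nu>)" "lie (?dX \<alpha> \<nu>) (?w \<rho>) = - lie (?w \<rho>) (?dX \<alpha> \<nu>)"
    "lie (?X \<nu>) (?dw \<alpha> \<rho>) = - lie (?dw \<alpha> \<rho>) (?X \<nu>)" for \<alpha> \<nu> \<rho>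
    by (rule lie_antisym)+
  have flip: "ip (field2 \<mu> \<nu> \<rho> j) e = ip e (field2 \<mu> \<nu> \<rho> j)" for \<nu> \<rho> by (rule ip_sym)
  have flip': "ip (lie e (?w \<mu>)) Y = ip Y (lie e (?w \<mu>))" for Y by (rule ip_sym)
  show ?thesis
    unfolding dcov_curl_def cov_curl_def anti curv_antisym[of \<kappa>]
    by (simp add: ip.add_left ip.add_right ip.diff_left ip.diff_right ip.minus_left ip.minus_right flip flip')
qed

lemma euler_lagrange_contraction:
  assumes "fst j \<in> U" "\<And>\<nu> B. ym_expr \<nu> (axis B 1) j = 0"
  shows "euler_lagrange contraction \<kappa> C j = jacobi_expr \<kappa> (axis C 1) j"
proof -
  let ?A1 = "range (\<lambda>\<alpha>::'m. {#\<alpha>#})" and ?A2 = "range (\<lambda>(\<alpha>::'m, \<beta>). {#\<alpha>, \<beta>#})"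
  let ?t = "\<lambda>I. (-1) ^ size I * total_deriv_multi I (du I C \<kappa> contraction) j"
  have "euler_lagrange contraction \<kappa> C j = sum ?t (insert {#} (?A1 \<union> ?A2))"
    unfolding euler_lagrange_def
  proof (rule Sum_any.expand_superset)
    show "{I. ?t I \<noteq> 0} \<subseteq> insert {#} (?A1 \<union> ?A2)"
    proof (rule subsetI, rule ccontr)
      fix I assume "I \<in> {I. ?t I \<noteq> 0}" "I \<notin> insert {#} (?A1 \<union> ?A2)"
      then show False using total_deriv_multi_du_other[OF assms(1), of I] by simp
    qed
  qed simp
  also have "\<dots> = ?t {#} + sum ?t (?A1 \<union> ?A2)"
    by (rule sum.insert) auto
  also have "sum ?t (?A1 \<union> ?A2) = sum ?t ?A1 + sum ?t ?A2"
    by (rule sum.union_disjoint) auto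
  also have "sum ?t ?A1 = - (\<Sum>\<alpha>\<in>UNIV. total_deriv \<alpha> (du {#\<alpha>#} C \<kappa> contraction) j)"
    by (subst sum.reindex) (auto simp: inj_on_def sum_negf)
  also have "sum ?t ?A2 = (\<Sum>I\<in>?A2. total_deriv_multi I (du I C \<kappa> contraction) j)"
    by (rule sum.cong) auto
  finally have "euler_lagrange contraction \<kappa> C j = fixed_field_jet j (unit_jet {#} C \<kappa>)
      - (\<Sum>\<alpha>\<in>UNIV. total_deriv \<alpha> (du {#\<alpha>#} C \<kappa> contraction) j)
      + (\<Sum>I\<in>?A2. total_deriv_multi I (du I C \<kappa> contraction) j)"
    by (simp add: du_contraction_empty[OF assms])
  also have "\<dots> = jacobi_expr \<kappa> (axis C 1) j"
    unfolding fixed_field_jet_unit_empty sum_total_deriv_du_single[OF assms(1)]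
      sum_total_deriv_multi_du_pair[OF assms(1)] jacobi_expr_def jacobi_term[symmetric]
    by (simp only: sum.distrib sum_subtractf right_diff_distrib distrib_left)
  finally show ?thesis .
qed

section \<open>The operator in components, with covariant derivatives\<close>

lemma nabla_upper_field:
  assumes "fst j \<in> U"
  shows "nabla_upper c \<alpha> (\<lambda>Z. vf_comp \<Xi> Z \<sigma>) A j
     = (field1 \<alpha> \<sigma> j + lie (jet_coord {#} \<alpha> j) (field \<sigma> j)) $ A"
proof -
  have "total_deriv \<alpha> (vf_comp \<Xi> A \<sigma>) j = field_jet \<sigma> j (total_vector \<alpha> j) $ A"
    using has_jet_derivative_nth[OF field_has_jet_derivative[OF assms]]
    by (rule total_deriv_cong[OF open_U assms vf_comp_field])
  then show ?thesis
    by (simp add: nabla_upper_def field_jet_total_vector lie_def lie_bracket_def conn_jet_coord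
        vf_comp_field)
qed

lemma ip_axis: "(\<Sum>A\<in>UNIV. Y $ A * \<delta> B A) = ip (axis B 1) Y"
proof -
  have "(\<Sum>A\<in>UNIV. \<Sum>A'\<in>UNIV. \<delta> A A' * axis B 1 $ A * Y $ A')
      = (\<Sum>A\<in>UNIV. if A = B then \<Sum>A'\<in>UNIV. \<delta> A A' * Y $ A' else 0)"
    by (rule sum.cong) (auto simp: axis_def)
  then show ?thesis
    by (simp add: ip_def metric_form_def mult.commute)
qed

lemma lie_axis: "lie (axis B 1) Y $ A = (\<Sum>C\<in>UNIV. c A B C * Y $ C)"
proof -
  have "(\<Sum>B'\<in>UNIV. \<Sum>C\<in>UNIV. c A B' C * axis B 1 $ B' * Y $ C)
      = (\<Sum>B'\<in>UNIV. if B' = B then \<Sum>C\<in>UNIV. c A B' C * Y $ C else 0)"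
    by (rule sum.cong) (auto simp: axis_def)
  then show ?thesis
    by (simp add: lie_def lie_bracket_def)
qed

text \<open>Here \<open>f\<close> stands for the expression under \<open>nabla_lower\<close>, which
  is identified with the curl only over \<open>U\<close>.\<close>

lemma cov_curl_total_deriv:
  assumes "fst j \<in> U" "\<And>j. fst j \<in> U \<Longrightarrow> f j = ip X (cov_curl \<mu> \<nu> j)"
  shows "total_deriv \<mu> f j = ip X (dcov_curl \<mu> \<nu> j)"
proof -
  have "has_jet_derivative (\<lambda>j. ip X (cov_curl \<mu> \<nu> j))
     (\<lambda>v. ip X (field1_jet \<mu> \<nu> j v + (lie (jet_coord {#} \<mu> j) (field_jet \<nu> j v) + lie (jet_coord {#} \<mu> v) (field \<nu> j))
     - (field1_jet \<nu> \<mu> j v + (lie (jet_coord {#} \<nu> j) (field_jet \<mu> j v) + lie (jet_coord {#} \<nu> v) (field \<mu> j))))) j"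
    unfolding cov_curl_def
    by (intro has_jet_derivative_linear[OF ip.bounded_linear_right] has_jet_derivative_add
        has_jet_derivative_diff field1_has_jet_derivative has_jet_derivative_lie
        has_jet_derivative_coord field_has_jet_derivative assms)
  from total_deriv_cong[OF open_U assms this]
  show ?thesis
    by (simp add: dcov_curl_def field2_def field_jet_total_vector)
qed

lemma jacobi_expr_components:
  assumes "fst j \<in> U"
  shows "(\<Sum>\<sigma>\<in>UNIV. \<Sum>\<beta>\<in>UNIV. \<Sum>\<alpha>\<in>UNIV. h $ \<nu> $ \<sigma> * h $ \<beta> $ \<alpha> *
         (nabla_lower c \<beta>
            (\<lambda>B' j. \<Sum>A\<in>UNIV. (nabla_upper c \<alpha> (\<lambda>Z. vf_comp \<Xi> Z \<sigma>) A j
                                - nabla_upper c \<sigma> (\<lambda>Z. vf_comp \<Xi> Z \<alpha>) A j) * \<delta> B' A)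
            B j
          + (\<Sum>D\<in>UNIV. \<Sum>A\<in>UNIV. \<Sum>Z\<in>UNIV.
               field_strength c D \<beta> \<sigma> j * c A B Z * vf_comp \<Xi> Z \<alpha> j * \<delta> A D)))
     = jacobi_expr \<nu> (axis B 1) j"
proof -
  \<comment> \<open>\<open>N\<close> and \<open>R\<close> hide the two summands so that
    \<open>h_sum\<close> can treat them as functions of the free indices and set \<sigma> = \<nu>
    and \<alpha> = \<beta>.\<close>
  define N where "N \<sigma> \<beta> \<alpha> = nabla_lower c \<beta>
            (\<lambda>B' j. \<Sum>A\<in>UNIV. (nabla_upper c \<alpha> (\<lambda>Z. vf_comp \<Xi> Z \<sigma>) A j
                                - nabla_upper c \<sigma> (\<lambda>Z. vf_comp \<Xi> Z \<alpha>) A j) * \<delta> B' A) B j" for \<sigma> \<beta> \<alpha>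
  define R where "R \<sigma> \<beta> \<alpha> = (\<Sum>D\<in>UNIV. \<Sum>A\<in>UNIV. \<Sum>Z\<in>UNIV.
               field_strength c D \<beta> \<sigma> j * c A B Z * vf_comp \<Xi> Z \<alpha> j * \<delta> A D)" for \<sigma> \<beta> \<alpha>
  let ?e = "axis B 1"
  have ip_lie: "(\<Sum>D\<in>UNIV. \<Sum>A\<in>UNIV. \<Sum>Z\<in>UNIV. Y $ D * c A B Z * W $ Z * \<delta> A D) = ip Y (lie ?e W)" for Y W
  proof -
    have "ip Y (lie ?e W) = (\<Sum>D\<in>UNIV. \<Sum>A\<in>UNIV. \<delta> D A * Y $ D * (\<Sum>Z\<in>UNIV. c A B Z * W $ Z))"
      unfolding ip_def metric_form_def lie_axis ..
    then show ?thesis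
      by (simp add: sum_distrib_left \<delta>_sym[of _ "_ :: 'g"] ac_simps)
  qed
  have K: "(\<Sum>A\<in>UNIV. (nabla_upper c \<alpha> (\<lambda>Z. vf_comp \<Xi> Z \<sigma>) A j'
       - nabla_upper c \<sigma> (\<lambda>Z. vf_comp \<Xi> Z \<alpha>) A j') * \<delta> B' A) = ip (axis B' 1) (cov_curl \<alpha> \<sigma> j')"
    if "fst j' \<in> U" for j' B' \<alpha> \<sigma>
    using that by (simp add: nabla_upper_field cov_curl_def flip: ip_axis)
  have N: "N \<nu> \<beta> \<beta> = ip ?e (dcov_curl \<beta> \<nu> j) + ip (cov_curl \<beta> \<nu> j) (lie ?e (jet_coord {#} \<beta> j))" for \<beta>
  proof -
    have "(\<Sum>A\<in>UNIV. \<Sum>C\<in>UNIV. ip (axis A 1) (cov_curl \<beta> \<nu> j) * c A B C * conn C \<beta> j)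
       = (\<Sum>A\<in>UNIV. \<Sum>D\<in>UNIV. \<Sum>C\<in>UNIV. cov_curl \<beta> \<nu> j $ D * c A B C * jet_coord {#} \<beta> j $ C * \<delta> A D)"
      by (subst (2) sum.swap) (simp add: sum_distrib_right sum_distrib_left conn_jet_coord ac_simps flip: ip_axis)
    also have "\<dots> = ip (cov_curl \<beta> \<nu> j) (lie ?e (jet_coord {#} \<beta> j))"
      by (subst sum.swap) (rule ip_lie)
    finally show ?thesis
      unfolding N_def nabla_lower_def
      using cov_curl_total_deriv[OF assms K] K[OF assms] by simp
  qed
  have R: "R \<nu> \<beta> \<beta> = ip (curv \<beta> \<nu> j) (lie ?e (field \<beta> j))" for \<beta>
    unfolding R_def field_strength_curv vf_comp_field by (rule ip_lie)
  have "(\<Sum>\<sigma>\<in>UNIV. \<Sum>\<beta>\<in>UNIV. \<Sum>\<alpha>\<in>UNIV. h $ \<nu> $ \<sigma> * h $ \<beta> $ \<alpha> * (N \<sigma> \<beta> \<alpha> + R \<sigma> \<beta> \<alpha>))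
      = (\<Sum>\<sigma>\<in>UNIV. h $ \<nu> $ \<sigma> * (\<Sum>\<beta>\<in>UNIV. \<Sum>\<alpha>\<in>UNIV. h $ \<beta> $ \<alpha> * (N \<sigma> \<beta> \<alpha> + R \<sigma> \<beta> \<alpha>)))"
    by (simp only: sum_distrib_left mult.assoc)
  also have "\<dots> = (\<Sum>\<beta>\<in>UNIV. k \<beta> \<nu> * (N \<nu> \<beta> \<beta> + R \<nu> \<beta> \<beta>))"
    by (simp only: h_sum) (simp add: k_def sum_distrib_left ac_simps)
  finally show ?thesis
    by (simp only: N_def[symmetric] R_def[symmetric] N R jacobi_expr_def)
qed

end

section \<open>The algebraic inputs from metric and Lie algebra\<close>

lemma lorentzian_diagonal_inverse:
  assumes "lorentzian_diagonal \<eta>" "\<mu> \<noteq> \<nu>"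
  shows "matrix_inv \<eta> $ \<mu> $ \<nu> = 0"
proof -
  have offdiag: "\<eta> $ \<alpha> $ \<beta> = 0" if "\<alpha> \<noteq> \<beta>" for \<alpha> \<beta>
    using assms(1) that by (simp add: lorentzian_diagonal_def)
  \<comment> \<open>The distinguished entry is nonzero, and every other entry has a negative product
    with it.\<close>
  have diag: "\<eta> $ \<alpha> $ \<alpha> \<noteq> 0" for \<alpha>
    using assms(1) unfolding lorentzian_diagonal_def by (metis less_irrefl mult_zero_left)
  define M where "M = (\<chi> \<alpha> \<beta>. if \<alpha> = \<beta> then 1 / \<eta> $ \<alpha> $ \<alpha> else 0)"
  have "\<eta> ** M = mat 1" "M ** \<eta> = mat 1"
    unfolding matrix_matrix_mult_def mat_def vec_eq_iff M_def
    using diag offdiag by (auto simp: if_distrib[of "\<lambda>x. _ * x"] if_distrib[of "\<lambda>x. x * _"] sum.delta' sum.delta cong: if_cong)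
  note M = this
  \<comment> \<open>\<open>matrix_inv\<close> is a choice, so the explicit \<open>M\<close> first
    shows that a two-sided inverse exists; uniqueness then identifies the chosen one with
    \<open>M\<close>.\<close>
  have "\<eta> ** matrix_inv \<eta> = mat 1 \<and> matrix_inv \<eta> ** \<eta> = mat 1"
    unfolding matrix_inv_def by (rule someI[of _ M]) (simp add: M)
  then have "matrix_inv \<eta> = M"
    by (metis M(1) matrix_mul_assoc matrix_mul_lid matrix_mul_rid)
  then show ?thesis using assms(2) by (simp add: M_def)
qed

lemma structure_constant_antisym:
  assumes "lie_algebra br" "indexed_basis T"
  shows "structure_constant br T A C B = - structure_constant br T A B C"
proof -
  have b: "bilinear br" and z: "\<And>x. br x x = 0" using assms(1) by (auto simp: lie_algebra_def)
  \<comment> \<open>Polarisation turns the vanishing of \<open>br x x\<close> into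
    antisymmetry.\<close>
  have "br (x + y) (x + y) = br x x + br y x + (br x y + br y y)" for x y
    by (simp add: bilinear_ladd[OF b] bilinear_radd[OF b])
  then have "br (T C) (T B) = - br (T B) (T C)"
    by (simp add: z eq_neg_iff_add_eq_0)
  then show ?thesis
    using assms(2) by (simp add: structure_constant_def representation_neg indexed_basis_def)
qed

theorem mainTheorem7:
  fixes U :: "'m::{finite,linorder} base set"
    and \<eta> h :: "'m metric"
    and br :: "'a::real_vector \<Rightarrow> 'a \<Rightarrow> 'a"
    and T :: "'g::finite \<Rightarrow> 'a"
    and \<epsilon> :: real
    and c :: "'g \<Rightarrow> 'g \<Rightarrow> 'g \<Rightarrow> real"
    and \<delta> :: "'g \<Rightarrow> 'g \<Rightarrow> real"
    and L :: "('m, 'g) jet \<Rightarrow> real"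
    and s :: "'m base \<Rightarrow> ('m, 'g) pot"
    and \<Xi> :: "'m base \<times> ('m, 'g) pot \<Rightarrow> ('m, 'g) pot"
  assumes U: "open U"
    and \<eta>: "lorentzian_diagonal \<eta>" "h = matrix_inv \<eta>"
    and br: "semisimple_lie_algebra br" "indexed_basis T"
    and c: "c = structure_constant br T"
    and \<delta>: "\<epsilon> = 1 \<or> \<epsilon> = - 1" "\<delta> = cartan_killing_metric \<epsilon> br T" "orthonormal_components \<delta>"
    and L: "L = yang_mills c \<delta> h"
    and s: "critical_section L U s"
    and \<Xi>: "smooth_map_on \<Xi> (U \<times> UNIV)"
  shows "jacobi_along L U s \<Xi> \<longleftrightarrow>
    (\<forall>x\<in>U. \<forall>\<nu> B.
      (\<Sum>\<sigma>\<in>UNIV. \<Sum>\<beta>\<in>UNIV. \<Sum>\<alpha>\<in>UNIV. h $ \<nu> $ \<sigma> * h $ \<beta> $ \<alpha> *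
         (nabla_lower c \<beta>
            (\<lambda>B' j. \<Sum>A\<in>UNIV. (nabla_upper c \<alpha> (\<lambda>Z. vf_comp \<Xi> Z \<sigma>) A j
                                - nabla_upper c \<sigma> (\<lambda>Z. vf_comp \<Xi> Z \<alpha>) A j) * \<delta> B' A)
            B (prolongation s x)
          + (\<Sum>D\<in>UNIV. \<Sum>A\<in>UNIV. \<Sum>Z\<in>UNIV.
               field_strength c D \<beta> \<sigma> (prolongation s x) * c A B Z
                 * vf_comp \<Xi> Z \<alpha> (prolongation s x) * \<delta> A D))) = 0)"
proof -
  have "lie_algebra br" using br(1) by (simp add: semisimple_lie_algebra_def)
  then interpret yang_mills_vertical_field c \<delta> h U \<Xi>
  proof unfold_locales
    show "c A C B = - c A B C" for A B C
      unfolding c using \<open>lie_algebra br\<close> br(2) by (rule structure_constant_antisym)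
    \<comment> \<open>Symmetry is read off the diagonal form in an orthonormal basis.\<close>
    show "\<delta> B A = \<delta> A B" for A B
      using \<delta>(3) unfolding orthonormal_components_def by metis
    show "h $ \<mu> $ \<nu> = 0" if "\<mu> \<noteq> \<nu>" for \<mu> \<nu>
      unfolding \<eta>(2) using \<eta>(1) that by (rule lorentzian_diagonal_inverse)
  qed (use U \<Xi> in auto)
  \<comment> \<open>An equality of values at each jet of the section, so the two vanishing
    conditions coincide index by index.\<close>
  have "euler_lagrange (vf_contraction \<Xi> L) \<nu> B (prolongation s x)
      = jacobi_expr \<nu> (axis B 1) (prolongation s x)" if "x \<in> U" for x \<nu> B
    unfolding L using that s
    by (intro euler_lagrange_contraction)
      (simp_all add: critical_section_def L prolongation_def euler_lagrange_yang_mills)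
  moreover have "fst (prolongation s x) \<in> U" if "x \<in> U" for x
    using that by (simp add: prolongation_def)
  ultimately show ?thesis
    unfolding jacobi_along_def by (simp add: jacobi_expr_components)
qed

end
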